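(* For every finite set $A\subset\mathbb{R}$, $$|A(A+A+A)|\gtrapprox |A|^{\frac{7}{4}+\frac{1}{284}},$$ where $A(A+A+A)=\{a(b+c+d): a,b,c,d\in A\}$.
   Context: For positive quantities $X,Y$, the notation $X\gtrapprox Y$ means that there exist absolute positive constants $C$ and $c$ such that $X\geq c\,Y/(\log X)^C$. All logarithms are to base 2. *)

theory Defs
  imports Complex_Main
begin

definition prod_triple_sum :: "real set \<Rightarrow> real set" where
  "prod_triple_sum A = {a * (b + c + d) | a b c d. a \<in> A \<and> b \<in> A \<and> c \<in> A \<and> d \<in> A}"

end

theory Submission
  imports Defs "HOL-Analysis.Convex" "HOL-Library.Set_Algebras" "HOL-Library.Discrete_Functions"
begin

text \<open>We may assume that \<open>A\<close> is positive. Let \<open>n = |A|\<close>, \<open>S = A + A\<close>, \<open>X = |A(A + A + A)|\<close>, and let \<open>E\<close> be the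
  multiplicative energy of \<open>A\<close>. Up to powers of a logarithm \<open>J\<close>, three inequalities hold:
  \<open>n^5 |S| \<le> X^2 E\<close>, by counting the collisions of \<open>a (b + s)\<close> with \<open>s \<in> S\<close>;
  \<open>E \<le> |S|^2\<close>, by Solymosi; and \<open>E^24 \<le> n^58 |S|^9\<close>. The first two alone give the exponent \<open>7/4\<close>.
  For the third, if \<open>E\<close> is large then many elements of \<open>A\<close> have many quotients in a small set; this makes
  popular differences rare, and a third moment argument with the Katz--Koester inclusion forces \<open>S\<close>
  to be large. Eliminating \<open>E\<close> and \<open>|S|\<close> gives \<open>n^137 \<le> X^78\<close>, and \<open>137/78 > 7/4 + 1/284\<close>.
  All incidence problems involve Cartesian products, for which the Szemeredi--Trotter bound has a
  short cell decomposition proof.\<close>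

section \<open>Dyadic sums and collisions\<close>

text \<open>The first two inequalities reach 7/4 only together with the trivial E \<le> n^3, and
  they are sharp only if E is near n^3 and |S| near n^(3/2). The third inequality excludes this
  corner: at E = n^3 it forces |S| to be at least n^(14/9), up to logarithms. Grouping b + c + d as
  b + s puts |S| on the helpful side of the collision count: a large S improves that count directly,
  a small S limits E. Positivity is more than a convenience. Every line that occurs has as slope a
  quotient of elements of \<open>A\<close> or the reciprocal of an element, so it is increasing, and
  for increasing lines a partition of the grid by rank already serves as a cell decomposition.
  Solymosi's argument relies on positive points as well. The three inequalities are stated with
  integer powers, so fractional exponents appear only at the very end.\<close>

lemma dyadic_sum_le:
  fixes f :: "'a \<Rightarrow> nat" and g :: "'a \<Rightarrow> real"
  assumes "finite I" and f: "\<And>i. i \<in> I \<Longrightarrow> f i < 2 ^ J" and g: "\<And>i. i \<in> I \<Longrightarrow> 0 \<le> g i"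
    and p: "p > 0"
  shows "(\<Sum>i\<in>I. real (f i) ^ p * g i) \<le> 2 ^ p * (\<Sum>j<J. (2 ^ j) ^ p * (\<Sum>i | i \<in> I \<and> 2 ^ j \<le> f i. g i))"
proof -
  \<comment> \<open>One level is enough: \<open>floor_log (f i)\<close> alone loses at most the
    factor \<open>2 ^ p\<close>, and the smaller levels only overcount. Nested level sets, not
    dyadic shells, appear because the incidence bounds are about thresholds.\<close>
  have pt: "real (f i) ^ p \<le> 2 ^ p * (\<Sum>j<J. (2 ^ j) ^ p * of_bool (2 ^ j \<le> f i))" if "i \<in> I" for i
  proof (cases "f i = 0")
    case True
    then show ?thesis using p by (simp add: sum_nonneg zero_power)
  next
    case False
    define k where "k = floor_log (f i)"
    have k1: "2 ^ k \<le> f i" and k2: "f i < 2 * 2 ^ k"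
      using False floor_log_exp2_le[of "f i"] floor_log_exp2_gt[of "f i"] by (auto simp: k_def)
    have "(2::nat) ^ k < 2 ^ J" using k1 f[OF that] by linarith
    then have "k < J" by simp
    have "real (f i) \<le> 2 * 2 ^ k"
      using k2 of_nat_le_iff[of "f i" "2 * 2 ^ k", where 'a = real] by simp
    then have "real (f i) ^ p \<le> (2 * 2 ^ k) ^ p" by (intro power_mono) auto
    also have "\<dots> = 2 ^ p * (\<Sum>j\<in>{k}. (2 ^ j) ^ p * of_bool (2 ^ j \<le> f i))"
      using k1 by (simp add: power_mult_distrib)
    also have "\<dots> \<le> 2 ^ p * (\<Sum>j<J. (2 ^ j) ^ p * of_bool (2 ^ j \<le> f i))"
      using \<open>k < J\<close> by (intro mult_left_mono sum_mono2) auto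
    finally show ?thesis .
  qed
  have "(\<Sum>i\<in>I. real (f i) ^ p * g i)
      \<le> (\<Sum>i\<in>I. (2 ^ p * (\<Sum>j<J. (2 ^ j) ^ p * of_bool (2 ^ j \<le> f i))) * g i)"
    by (intro sum_mono mult_right_mono pt g)
  also have "\<dots> = 2 ^ p * (\<Sum>i\<in>I. \<Sum>j<J. (2 ^ j) ^ p * (of_bool (2 ^ j \<le> f i) * g i))"
    by (simp add: sum_distrib_left sum_distrib_right mult.assoc del: sum_of_bool_mult_eq sum_mult_of_bool_eq)
  also have "\<dots> = 2 ^ p * (\<Sum>j<J. (2 ^ j) ^ p * (\<Sum>i\<in>I. of_bool (2 ^ j \<le> f i) * g i))"
    by (subst sum.swap) (simp add: sum_distrib_left del: sum_of_bool_mult_eq)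
  also have "\<dots> = 2 ^ p * (\<Sum>j<J. (2 ^ j) ^ p * (\<Sum>i | i \<in> I \<and> 2 ^ j \<le> f i. g i))"
    using assms(1) by (simp add: Int_def)
  finally show ?thesis .
qed

lemma power_sum_le_dyadic:
  fixes f :: "'a \<Rightarrow> nat"
  assumes "finite I" and "\<And>i. i \<in> I \<Longrightarrow> f i < 2 ^ J" and "p > 0"
    and M: "\<And>t. t > 0 \<Longrightarrow> real t ^ p * real (card {i \<in> I. t \<le> f i}) \<le> M"
  shows "(\<Sum>i\<in>I. real (f i) ^ p) \<le> 2 ^ p * real J * M"
proof -
  have "(\<Sum>i\<in>I. real (f i) ^ p) \<le> 2 ^ p * (\<Sum>j<J. (2 ^ j) ^ p * real (card {i \<in> I. 2 ^ j \<le> f i}))"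
    using dyadic_sum_le[of I f J "\<lambda>_. 1" p] assms by simp
  also have "\<dots> \<le> 2 ^ p * (\<Sum>j<J. M)"
    using M[of "2 ^ j" for j] by (intro mult_left_mono sum_mono) auto
  finally show ?thesis by simp
qed

lemma obtain_dyadic_level:
  fixes f :: "'a \<Rightarrow> nat"
  assumes "finite I" and "\<And>i. i \<in> I \<Longrightarrow> f i < 2 ^ J" and "p > 0" and "J > 0"
  obtains t where "t > 0" and "(\<Sum>i\<in>I. real (f i) ^ p) \<le> 2 ^ p * real J * (real t ^ p * real (card {i \<in> I. t \<le> f i}))"
proof -
  define h where "h j = (2 ^ j) ^ p * real (card {i \<in> I. 2 ^ j \<le> f i})" for j :: nat
  have "(\<Sum>i\<in>I. real (f i) ^ p) \<le> 2 ^ p * (\<Sum>j<J. h j)"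
    using dyadic_sum_le[of I f J "\<lambda>_. 1" p] assms by (simp add: h_def)
  moreover obtain k where "k < J" and k: "\<And>j. j < J \<Longrightarrow> h j \<le> h k"
  proof -
    have "\<exists>k\<in>{..<J}. \<forall>j\<in>{..<J}. h j \<le> h k"
      using \<open>J > 0\<close> Max_in[of "h ` {..<J}"] Max_ge[of "h ` {..<J}"]
      by (metis (no_types, lifting) finite_imageI finite_lessThan image_iff image_eqI image_is_empty lessThan_empty_iff not_gr0)
    then show ?thesis using that by auto
  qed
  moreover have "(\<Sum>j<J. h j) \<le> (\<Sum>j<J. h k)" by (intro sum_mono k) auto
  then have "2 ^ p * (\<Sum>j<J. h j) \<le> 2 ^ p * (real J * h k)" by (intro mult_left_mono) auto
  ultimately have "(\<Sum>i\<in>I. real (f i) ^ p) \<le> 2 ^ p * (real J * h k)" by linarith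
  then show ?thesis by (intro that[of "2 ^ k"]) (auto simp: h_def mult.assoc)
qed

text \<open>Cauchy-Schwarz over the fibres of \<open>f\<close>: their sizes add up to
  \<open>card T\<close>, the squares of their sizes to the number of colliding pairs.\<close>

lemma card_square_le_collisions:
  fixes f :: "'a \<Rightarrow> 'b"
  assumes "finite T"
  shows "(real (card T))\<^sup>2 \<le> real (card (f ` T)) * real (card {(s, t) \<in> T \<times> T. f s = f t})"
proof -
  have 1: "(\<Sum>y\<in>f ` T. card {s \<in> T. f s = y}) = card T"
    using sum.group[OF assms, of "f ` T" f "\<lambda>_. 1::nat"] assms by simp
  have "{(s, t) \<in> T \<times> T. f s = f t} = (SIGMA s : T. {t \<in> T. f t = f s})" by auto
  then have "card {(s, t) \<in> T \<times> T. f s = f t} = (\<Sum>s\<in>T. card {t \<in> T. f t = f s})"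
    using assms by simp
  also have "\<dots> = (\<Sum>y\<in>f ` T. \<Sum>s | s \<in> T \<and> f s = y. card {t \<in> T. f t = f s})"
    by (rule sum.group[symmetric]) (use assms in auto)
  also have "\<dots> = (\<Sum>y\<in>f ` T. (card {s \<in> T. f s = y})\<^sup>2)"
    by (intro sum.cong) (auto simp: power2_eq_square)
  finally have 2: "real (card {(s, t) \<in> T \<times> T. f s = f t}) = (\<Sum>y\<in>f ` T. (real (card {s \<in> T. f s = y}))\<^sup>2)"
    by simp
  show ?thesis
    using sum_squared_le_sum_of_squares[of "\<lambda>y. real (card {s \<in> T. f s = y})" "f ` T"]
    unfolding 2 1[symmetric] by (simp add: mult.commute)
qed

section \<open>Incidences with Cartesian products\<close>

text \<open>Blocks are cut by rank, not by length, so that each holds at most \<open>u\<close>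
  elements however the set is spaced.\<close>

definition rank_in :: "real set \<Rightarrow> real \<Rightarrow> nat" where
  "rank_in X x = card {z \<in> X. z < x}"

lemma rank_in_mono: "finite X \<Longrightarrow> x \<le> y \<Longrightarrow> rank_in X x \<le> rank_in X y"
  unfolding rank_in_def by (intro card_mono) auto

lemma rank_in_strict_mono: "finite X \<Longrightarrow> x \<in> X \<Longrightarrow> x < y \<Longrightarrow> rank_in X x < rank_in X y"
  unfolding rank_in_def by (intro psubset_card_mono) auto

lemma rank_in_less_card: "finite X \<Longrightarrow> x \<in> X \<Longrightarrow> rank_in X x < card X"
  unfolding rank_in_def by (intro psubset_card_mono) auto

lemma card_rank_block_le:
  assumes "finite X" and "u > 0"
  shows "card {x \<in> X. rank_in X x div u = k} \<le> u"
proof -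
  have "inj_on (rank_in X) X"
    using rank_in_strict_mono[OF assms(1)] by (intro linorder_inj_onI) (fastforce+)
  then have "card {x \<in> X. rank_in X x div u = k} = card (rank_in X ` {x \<in> X. rank_in X x div u = k})"
    by (intro card_image[symmetric]) (auto intro: inj_on_subset)
  also have "\<dots> \<le> card {k * u..<k * u + u}"
  proof (intro card_mono)
    show "rank_in X ` {x \<in> X. rank_in X x div u = k} \<subseteq> {k * u..<k * u + u}"
      using dividend_less_div_times[OF assms(2)] by (fastforce simp: add.commute)
  qed simp
  finally show ?thesis by simp
qed

definition line_hits :: "real set \<Rightarrow> real set \<Rightarrow> real \<times> real \<Rightarrow> real set" where
  "line_hits X Y l = {x \<in> X. fst l * x + snd l \<in> Y}"

lemma finite_line_hits [simp]: "finite X \<Longrightarrow> finite (line_hits X Y l)"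
  by (simp add: line_hits_def)

text \<open>Along an increasing line the block indices of both coordinates are monotone, so their
  sum takes few values, and all but that many hits have an earlier hit of the same line in the same
  cell. Two points determine their line, so the repeated hits are counted by pairs of grid points
  sharing a cell.\<close>

lemma incidences_le_blocks:
  assumes X: "finite X" and Y: "finite Y" and L: "finite L" and pos: "\<And>l. l \<in> L \<Longrightarrow> fst l > 0"
    and u: "u > 0" and v: "v > 0"
  shows "(\<Sum>l\<in>L. card (line_hits X Y l))
    \<le> ((card X - 1) div u + (card Y - 1) div v + 1) * card L + card X * card Y * (u * v)"
proof -
  define \<alpha> where "\<alpha> x = rank_in X x div u" for x
  define \<beta> where "\<beta> y = rank_in Y y div v" for y
  define \<gamma> where "\<gamma> l x = \<alpha> x + \<beta> (fst l * x + snd l)" for l x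
  define R where "R = (card X - 1) div u + (card Y - 1) div v"
  define W where "W l = {x \<in> line_hits X Y l. \<exists>x'\<in>line_hits X Y l. x' < x \<and> \<gamma> l x' = \<gamma> l x}" for l
  have finW: "finite (W l)" for l using X by (simp add: W_def)
  have \<gamma>R: "\<gamma> l x \<le> R" if "x \<in> line_hits X Y l" for l x
    using that rank_in_less_card[OF X, of x] rank_in_less_card[OF Y, of "fst l * x + snd l"]
    unfolding \<gamma>_def \<alpha>_def \<beta>_def R_def line_hits_def by (intro add_mono div_le_mono) auto
  have line: "card (line_hits X Y l) \<le> R + 1 + card (W l)" for l
  proof -
    have "inj_on (\<gamma> l) (line_hits X Y l - W l)"
      by (intro linorder_inj_onI) (auto simp: W_def)
    then have "card (line_hits X Y l - W l) = card (\<gamma> l ` (line_hits X Y l - W l))"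
      by (simp add: card_image)
    also have "\<dots> \<le> card {..R}" using \<gamma>R[of _ l] by (intro card_mono) auto
    finally have "card (line_hits X Y l - W l) \<le> R + 1" by simp
    moreover have "card (line_hits X Y l) = card (line_hits X Y l - W l) + card (W l)"
      using card_Diff_subset[of "W l" "line_hits X Y l"] card_mono[of "line_hits X Y l" "W l"] X finW
      by (auto simp: W_def)
    ultimately show ?thesis by simp
  qed
  define h where "h l x = (SOME x'. x' \<in> line_hits X Y l \<and> x' < x \<and> \<gamma> l x' = \<gamma> l x)" for l x
  have h: "h l x \<in> line_hits X Y l \<and> h l x < x \<and> \<gamma> l (h l x) = \<gamma> l x" if "x \<in> W l" for l x
    using that someI_ex[of "\<lambda>x'. x' \<in> line_hits X Y l \<and> x' < x \<and> \<gamma> l x' = \<gamma> l x"]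
    by (auto simp: W_def h_def)
  define D where "D = (SIGMA z : X \<times> Y. {x' \<in> X. \<alpha> x' = \<alpha> (fst z)} \<times> {y' \<in> Y. \<beta> y' = \<beta> (snd z)})"
  define F where "F = (\<lambda>(l, x). ((x, fst l * x + snd l), (h l x, fst l * h l x + snd l)))"
  have "inj_on F (SIGMA l : L. W l)"
  proof (rule inj_onI, clarify)
    fix m c x m' c' x'
    assume *: "F ((m, c), x) = F ((m', c'), x')" and W: "x \<in> W (m, c)"
    have [simp]: "x' = x" and hh: "h (m', c') x = h (m, c) x" and e1: "m' * x + c' = m * x + c"
      and e2: "m' * h (m, c) x + c' = m * h (m, c) x + c"
      using * by (auto simp: F_def)
    have "(m' - m) * (x - h (m, c) x) = 0" using e1 e2 by (simp add: algebra_simps)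
    with h[OF W] have "m' = m" by auto
    with e1 show "((m, c) = (m', c')) \<and> x = x'" by simp
  qed
  moreover have "F ` (SIGMA l : L. W l) \<subseteq> D"
  proof (rule image_subsetI, clarify)
    fix m c x assume l: "(m, c) \<in> L" and x: "x \<in> W (m, c)"
    have "m * h (m, c) x + c \<le> m * x + c" using pos[OF l] h[OF x] by simp
    then have "\<alpha> (h (m, c) x) \<le> \<alpha> x" "\<beta> (m * h (m, c) x + c) \<le> \<beta> (m * x + c)"
      unfolding \<alpha>_def \<beta>_def using h[OF x] X Y by (auto intro!: div_le_mono rank_in_mono)
    moreover have "\<alpha> (h (m, c) x) + \<beta> (m * h (m, c) x + c) = \<alpha> x + \<beta> (m * x + c)"
      using h[OF x] by (simp add: \<gamma>_def)
    \<comment> \<open>Neither index can drop along the line, so equal sums force equal summands: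
      both hits lie in one cell.\<close>
    ultimately have "\<alpha> (h (m, c) x) = \<alpha> x" "\<beta> (m * h (m, c) x + c) = \<beta> (m * x + c)" by linarith+
    then show "F ((m, c), x) \<in> D" using x h[OF x] by (auto simp: F_def D_def W_def line_hits_def)
  qed
  moreover have "finite D" using X Y by (auto simp: D_def)
  ultimately have "card (SIGMA l : L. W l) \<le> card D" by (intro card_inj_on_le)
  also have "card D = (\<Sum>z\<in>X \<times> Y. card {x' \<in> X. \<alpha> x' = \<alpha> (fst z)} * card {y' \<in> Y. \<beta> y' = \<beta> (snd z)})"
    using X Y by (simp add: D_def card_cartesian_product)
  also have "\<dots> \<le> (\<Sum>z\<in>X \<times> Y. u * v)"
    unfolding \<alpha>_def \<beta>_def by (intro sum_mono mult_le_mono card_rank_block_le X Y u v)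
  also have "\<dots> = card X * card Y * (u * v)" by (simp add: card_cartesian_product)
  finally have "(\<Sum>l\<in>L. card (W l)) \<le> card X * card Y * (u * v)" using L finW by simp
  moreover have "(\<Sum>l\<in>L. card (line_hits X Y l)) \<le> (\<Sum>l\<in>L. R + 1 + card (W l))"
    by (intro sum_mono line)
  moreover have "\<dots> = (R + 1) * card L + (\<Sum>l\<in>L. card (W l))" by (subst sum.distrib) simp
  ultimately show ?thesis by (simp add: R_def)
qed

lemma card_line_hits_le:
  assumes "finite X" and "finite Y" and "fst l > 0"
  shows "card (line_hits X Y l) \<le> card X" and "card (line_hits X Y l) \<le> card Y"
proof -
  show "card (line_hits X Y l) \<le> card X" using assms by (intro card_mono) (auto simp: line_hits_def)
  have "inj_on (\<lambda>x. fst l * x + snd l) (line_hits X Y l)" using assms(3) by (auto intro!: inj_onI)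
  then show "card (line_hits X Y l) \<le> card Y"
    by (rule card_inj_on_le) (use assms in \<open>auto simp: line_hits_def\<close>)
qed

text \<open>A line of positive slope is a chain for the product order, so it passes through few cells of a
  partition of the grid into blocks of consecutive elements. Optimising the block sizes gives the
  Szemeredi--Trotter bound.\<close>

theorem grid_szemeredi_trotter:
  assumes X: "finite X" and Y: "finite Y" and L: "finite L" and pos: "\<And>l. l \<in> L \<Longrightarrow> fst l > 0"
    and I: "I = (\<Sum>l\<in>L. real (card (line_hits X Y l)))" and big: "2 * real (card L) \<le> I"
  shows "I ^ 3 \<le> 162 * (real (card L))\<^sup>2 * (real (card X))\<^sup>2 * (real (card Y))\<^sup>2"
proof (cases "L = {}")
  case True
  then show ?thesis using I by simp
next
  case False
  define n x y where "n = real (card L)" and "x = real (card X)" and "y = real (card Y)"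
  define \<kappa> where "\<kappa> = I / n"
  have n: "n > 0" using False L by (simp add: n_def card_gt_0_iff)
  have In: "I = \<kappa> * n" using n by (simp add: \<kappa>_def)
  have \<kappa>: "\<kappa> \<ge> 2" using big n unfolding \<kappa>_def n_def[symmetric] by (simp add: field_simps)
  have "I \<le> (\<Sum>l\<in>L. x)" "I \<le> (\<Sum>l\<in>L. y)"
    unfolding I x_def y_def by (intro sum_mono; use card_line_hits_le[OF X Y] pos in simp)+
  then have \<kappa>x: "\<kappa> \<le> x" and \<kappa>y: "\<kappa> \<le> y" using n by (auto simp: In n_def[symmetric] mult.commute)
  \<comment> \<open>\<kappa> is the average number of hits per line. The 8 makes \<open>R\<close> at
    most \<kappa> / 2, so that its term is absorbed by the left side: for \<kappa> \<ge> 8 both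
    quotients and the extra 1 are at most \<kappa> / 8, for smaller \<kappa> both quotients vanish
    and \<kappa> \<ge> 2 suffices. As \<kappa> is at most \<open>x\<close> and \<open>y\<close>,
    rounding turns 8 into 9, and 162 = 2 * 9 * 9.\<close>
  define u v where "u = nat \<lfloor>8 * x / \<kappa>\<rfloor> + 1" and "v = nat \<lfloor>8 * y / \<kappa>\<rfloor> + 1"
  have block: "real ((card Z - 1) div w) \<le> \<kappa> / 8 \<and> (\<kappa> < 8 \<longrightarrow> (card Z - 1) div w = 0) \<and> real w \<le> 9 * z / \<kappa> \<and> w > 0"
    if z: "z = real (card Z)" "\<kappa> \<le> z" and w: "w = nat \<lfloor>8 * z / \<kappa>\<rfloor> + 1" for Z :: "real set" and z w
  proof -
    have "8 * z / \<kappa> \<ge> 0" using z \<kappa> by simp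
    then have w1: "8 * z / \<kappa> < real w" and w2: "real w \<le> 8 * z / \<kappa> + 1"
      unfolding w by linarith+
    have "real ((card Z - 1) div w) \<le> real (card Z - 1) / real w"
      by (rule of_nat_div_le_of_nat)
    also have "\<dots> \<le> z / real w" using z by (intro divide_right_mono) auto
    also have "\<dots> \<le> z / (8 * z / \<kappa>)"
    proof (intro divide_left_mono)
      have "0 < 8 * z / \<kappa>" using z \<kappa> by simp
      with w1 show "0 < real w * (8 * z / \<kappa>)" by (intro mult_pos_pos) linarith+
    qed (use w1 z \<kappa> in auto)
    also have "\<dots> = \<kappa> / 8" using z \<kappa> by simp
    finally have 1: "real ((card Z - 1) div w) \<le> \<kappa> / 8" .
    then have "\<kappa> < 8 \<Longrightarrow> (card Z - 1) div w = 0" by linarith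
    moreover have "real w \<le> 9 * z / \<kappa>" using w2 z \<kappa> by (simp add: field_simps)
    ultimately show ?thesis using 1 w by simp
  qed
  note bu = block[OF x_def \<kappa>x u_def] and bv = block[OF y_def \<kappa>y v_def]
  define R where "R = (card X - 1) div u + (card Y - 1) div v + 1"
  have R: "real R \<le> \<kappa> / 2"
  proof (cases "\<kappa> < 8")
    case True
    then show ?thesis using bu bv \<kappa> by (simp add: R_def)
  next
    case False
    then show ?thesis using bu bv by (simp add: R_def)
  qed
  have "I \<le> real (R * card L + card X * card Y * (u * v))"
  proof -
    have "(\<Sum>l\<in>L. card (line_hits X Y l)) \<le> R * card L + card X * card Y * (u * v)"
      unfolding R_def using incidences_le_blocks[OF X Y L pos, of u v] bu bv by simp
    then have "real (\<Sum>l\<in>L. card (line_hits X Y l)) \<le> real (R * card L + card X * card Y * (u * v))"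
      by (rule of_nat_mono)
    then show ?thesis by (simp add: I)
  qed
  also have "\<dots> = real R * n + x * y * (real u * real v)" by (simp add: n_def x_def y_def)
  also have "\<dots> \<le> \<kappa> / 2 * n + x * y * ((9 * x / \<kappa>) * (9 * y / \<kappa>))"
    using R bu bv n \<kappa>x \<kappa>y \<kappa> by (intro add_mono mult_right_mono mult_left_mono mult_mono) auto
  finally have "\<kappa> * n \<le> 2 * (x * y * ((9 * x / \<kappa>) * (9 * y / \<kappa>)))" by (simp add: In)
  also have "\<dots> = 162 * x\<^sup>2 * y\<^sup>2 / \<kappa>\<^sup>2" by (simp add: power2_eq_square)
  finally have "\<kappa> ^ 3 * n \<le> 162 * x\<^sup>2 * y\<^sup>2"
    using \<kappa> by (simp add: field_simps power2_eq_square power3_eq_cube)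
  then have "n\<^sup>2 * (\<kappa> ^ 3 * n) \<le> n\<^sup>2 * (162 * x\<^sup>2 * y\<^sup>2)" by (intro mult_left_mono) auto
  then show ?thesis unfolding In n_def[symmetric] x_def[symmetric] y_def[symmetric]
    by (simp add: power_mult_distrib power2_eq_square power3_eq_cube mult_ac)
qed

corollary card_rich_lines_le:
  assumes X: "finite X" and Y: "finite Y" and L: "finite L" and pos: "\<And>l. l \<in> L \<Longrightarrow> fst l > 0"
    and rich: "\<And>l. l \<in> L \<Longrightarrow> t \<le> card (line_hits X Y l)" and t: "2 \<le> t"
  shows "real t ^ 3 * real (card L) \<le> 162 * (real (card X))\<^sup>2 * (real (card Y))\<^sup>2"
proof (cases "L = {}")
  case False
  define I where "I = (\<Sum>l\<in>L. real (card (line_hits X Y l)))"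
  have n: "real (card L) > 0" using False L by (simp add: card_gt_0_iff)
  have "(\<Sum>l\<in>L. real t) \<le> I" unfolding I_def using rich by (intro sum_mono) auto
  then have I: "real t * real (card L) \<le> I" by (simp add: mult.commute)
  have "2 * real (card L) \<le> real t * real (card L)" using t by (intro mult_right_mono) auto
  with I have "I ^ 3 \<le> 162 * (real (card L))\<^sup>2 * (real (card X))\<^sup>2 * (real (card Y))\<^sup>2"
    by (intro grid_szemeredi_trotter[OF X Y L pos I_def]) auto
  moreover have "(real t * real (card L)) ^ 3 \<le> I ^ 3" using I by (intro power_mono) auto
  ultimately have "(real (card L))\<^sup>2 * (real t ^ 3 * real (card L))
      \<le> (real (card L))\<^sup>2 * (162 * (real (card X))\<^sup>2 * (real (card Y))\<^sup>2)"
    by (simp add: power_mult_distrib power2_eq_square power3_eq_cube mult_ac)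
  then show ?thesis using n by (simp only: mult_le_cancel_left_pos zero_less_power)
qed simp

section \<open>Multiplicative energy\<close>

definition ratio_rep :: "real set \<Rightarrow> real \<Rightarrow> nat" where
  "ratio_rep A l = card {a \<in> A. l * a \<in> A}"

definition ratios :: "real set \<Rightarrow> real set" where
  "ratios A = (\<lambda>(a, b). a / b) ` (A \<times> A)"

definition mult_energy :: "real set \<Rightarrow> real" where
  "mult_energy A = (\<Sum>l\<in>ratios A. (real (ratio_rep A l))\<^sup>2)"

lemma finite_ratios [simp]: "finite A \<Longrightarrow> finite (ratios A)"
  by (simp add: ratios_def)

lemma card_ratios_le: "finite A \<Longrightarrow> card (ratios A) \<le> (card A)\<^sup>2"
  unfolding ratios_def power2_eq_square by (metis card_cartesian_product card_image_le finite_cartesian_product)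

lemma ratio_rep_le: "finite A \<Longrightarrow> ratio_rep A l \<le> card A"
  unfolding ratio_rep_def by (intro card_mono) auto

lemma ratios_pos: "l \<in> ratios A \<Longrightarrow> (\<And>a. a \<in> A \<Longrightarrow> a > 0) \<Longrightarrow> l > 0"
  by (auto simp: ratios_def)

section \<open>Second moments of incidences, and collisions of a (b + c)\<close>

lemma sum_line_hits_le:
  assumes "finite \<Lambda>" and "finite Z" and "finite B"
  shows "(\<Sum>l\<in>\<Lambda> \<times> Z. card (line_hits B B l)) \<le> card \<Lambda> * (card B)\<^sup>2"
proof -
  \<comment> \<open>Each point of \<open>B \<times> B\<close> lies on exactly one line of slope
    \<open>m\<close>.\<close>
  have "(\<Sum>y\<in>Z. card (line_hits B B (m, y))) \<le> (card B)\<^sup>2" for m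
  proof -
    have "(\<Sum>y\<in>Z. card (line_hits B B (m, y))) = card (SIGMA y : Z. line_hits B B (m, y))"
      using assms by simp
    also have "\<dots> \<le> card (B \<times> B)"
      using assms by (intro card_inj_on_le[of "\<lambda>(y, x). (x, m * x + y)"])
        (auto simp: inj_on_def line_hits_def)
    finally show ?thesis by (simp add: card_cartesian_product power2_eq_square)
  qed
  then have "(\<Sum>m\<in>\<Lambda>. \<Sum>y\<in>Z. card (line_hits B B (m, y))) \<le> (\<Sum>m\<in>\<Lambda>. (card B)\<^sup>2)"
    by (intro sum_mono)
  then show ?thesis by (simp add: sum.cartesian_product case_prod_beta)
qed

lemma level_card_le_sum:
  fixes f :: "'a \<Rightarrow> nat"
  assumes "finite I"
  shows "t * card {i \<in> I. t \<le> f i} \<le> sum f I"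
proof -
  have "t * card {i \<in> I. t \<le> f i} = (\<Sum>i | i \<in> I \<and> t \<le> f i. t)" by simp
  also have "\<dots> \<le> sum f {i \<in> I. t \<le> f i}" by (intro sum_mono) auto
  also have "\<dots> \<le> sum f I" using assms by (intro sum_mono2) auto
  finally show ?thesis .
qed

lemma sum_line_hits_square_le:
  assumes \<Lambda>: "finite \<Lambda>" "\<And>m. m \<in> \<Lambda> \<Longrightarrow> m > 0" and Z: "finite Z" and B: "finite B"
    and small: "card \<Lambda> \<le> (card B)\<^sup>2" and J: "card B < 2 ^ J"
  shows "(\<Sum>l\<in>\<Lambda> \<times> Z. (real (card (line_hits B B l)))\<^sup>2) \<le> 52 * real J * sqrt (real (card \<Lambda>)) * real (card B) ^ 3"
proof -
  define m b where "m = real (card \<Lambda>)" and "b = real (card B)"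
  define f where "f l = card (line_hits B B l)" for l
  have f_le: "f l \<le> card B" if "l \<in> \<Lambda> \<times> Z" for l
    unfolding f_def using card_line_hits_le(1)[OF B B, of l] \<Lambda> that by auto
  have M: "real t ^ 2 * real (card {l \<in> \<Lambda> \<times> Z. t \<le> f l}) \<le> 13 * sqrt m * b ^ 3" if t: "t > 0" for t
  proof -
    define k where "k = real (card {l \<in> \<Lambda> \<times> Z. t \<le> f l})"
    have "t * card {l \<in> \<Lambda> \<times> Z. t \<le> f l} \<le> card \<Lambda> * (card B)\<^sup>2"
      using level_card_le_sum[of "\<Lambda> \<times> Z" t f] sum_line_hits_le[OF \<Lambda>(1) Z B] \<Lambda>(1) Z
      unfolding f_def by simp
    then have "real (t * card {l \<in> \<Lambda> \<times> Z. t \<le> f l}) \<le> real (card \<Lambda> * (card B)\<^sup>2)" by (rule of_nat_mono)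
    then have 1: "real t * k \<le> m * b\<^sup>2" by (simp add: k_def m_def b_def)
    show ?thesis
    proof (cases "t = 1")
      case True
      have "m = sqrt m * sqrt m" by (simp add: m_def)
      also have "\<dots> \<le> sqrt m * b"
      proof (intro mult_left_mono)
        have "m \<le> b\<^sup>2" using of_nat_mono[OF small, where 'a = real] by (simp add: m_def b_def)
        then show "sqrt m \<le> b" by (intro real_le_lsqrt) (auto simp: b_def)
      qed (simp add: m_def)
      finally have "m * b\<^sup>2 \<le> sqrt m * b * b\<^sup>2" by (intro mult_right_mono) auto
      with 1 True have "k \<le> sqrt m * b ^ 3" by (simp add: power2_eq_square power3_eq_cube mult.assoc)
      also have "\<dots> \<le> 13 * (sqrt m * b ^ 3)" by (simp add: m_def b_def)
      finally show ?thesis using True by (simp add: k_def mult.assoc)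
    next
      case False
      have 2: "real t ^ 3 * k \<le> 162 * b\<^sup>2 * b\<^sup>2"
        unfolding k_def b_def by (rule card_rich_lines_le) (use \<Lambda> Z B False t in \<open>auto simp: f_def\<close>)
      have "(real t ^ 2 * k)\<^sup>2 = (real t * k) * (real t ^ 3 * k)"
        by (simp add: power2_eq_square power3_eq_cube mult_ac)
      also have "\<dots> \<le> (m * b\<^sup>2) * (162 * b\<^sup>2 * b\<^sup>2)"
        by (rule mult_mono[OF 1 2]) (auto simp: k_def m_def)
      also have "\<dots> \<le> 13\<^sup>2 * (m * b ^ 6)" by (simp add: m_def b_def eval_nat_numeral mult_ac)
      also have "\<dots> = (13 * sqrt m * b ^ 3)\<^sup>2"
        by (simp add: power_mult_distrib m_def flip: power_mult)
      finally show ?thesis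
        unfolding k_def[symmetric] by (rule power2_le_imp_le) (auto simp: m_def b_def)
    qed
  qed
  have "(\<Sum>l\<in>\<Lambda> \<times> Z. real (f l) ^ 2) \<le> 2 ^ 2 * real J * (13 * sqrt m * b ^ 3)"
    by (rule power_sum_le_dyadic) (use \<Lambda>(1) Z M f_le J in \<open>auto intro: le_less_trans\<close>)
  then show ?thesis by (simp add: f_def m_def b_def)
qed

lemma level_card_le_energy:
  assumes "finite A"
  shows "(real t)\<^sup>2 * real (card {l \<in> ratios A. t \<le> ratio_rep A l}) \<le> mult_energy A"
proof -
  have "(real t)\<^sup>2 * real (card {l \<in> ratios A. t \<le> ratio_rep A l})
      = (\<Sum>l | l \<in> ratios A \<and> t \<le> ratio_rep A l. (real t)\<^sup>2)" by simp
  also have "\<dots> \<le> (\<Sum>l | l \<in> ratios A \<and> t \<le> ratio_rep A l. (real (ratio_rep A l))\<^sup>2)"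
    by (intro sum_mono power_mono) auto
  also have "\<dots> \<le> mult_energy A"
    unfolding mult_energy_def using assms by (intro sum_mono2) auto
  finally show ?thesis .
qed

lemma mult_energy_nonneg: "0 \<le> mult_energy A"
  by (simp add: mult_energy_def sum_nonneg)

text \<open>With l = a' / a, the equation a (b + c) = a' (b' + c') says b - l b' = l c' - c. Calling
  this value y puts (b', b) on the line of slope l and intercept y, and (c', c) on the line of slope
  l and intercept -y. \<open>Z\<close> collects the possible y.\<close>

lemma card_collisions_le:
  assumes A: "finite A" "\<And>a. a \<in> A \<Longrightarrow> a > 0" and B: "finite B" and C: "finite C"
  defines "f \<equiv> (\<lambda>(a, b, c). a * (b + c))"
    and "Z \<equiv> (\<lambda>(l, b, b'). b - l * b') ` (ratios A \<times> B \<times> B)"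
  shows "card {(s, t) \<in> (A \<times> B \<times> C) \<times> (A \<times> B \<times> C). f s = f t}
    \<le> (\<Sum>z\<in>ratios A \<times> Z. ratio_rep A (fst z) *
          (card (line_hits B B z) * card (line_hits C C (fst z, - snd z))))"
proof -
  let ?T = "(SIGMA z : ratios A \<times> Z. {a \<in> A. fst z * a \<in> A} \<times> line_hits B B z \<times> line_hits C C (fst z, - snd z))"
  define \<phi> :: "(real \<times> real \<times> real) \<times> (real \<times> real \<times> real) \<Rightarrow> (real \<times> real) \<times> (real \<times> real \<times> real)"
    where "\<phi> = (\<lambda>((a, b, c), (a', b', c')). ((a' / a, b - a' / a * b'), a, b', c'))"
  have fin: "finite ?T" using A B C by (auto simp: Z_def)
  have "inj_on \<phi> {(s, t) \<in> (A \<times> B \<times> C) \<times> (A \<times> B \<times> C). f s = f t}"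
  proof (rule inj_onI, clarify)
    fix a b c a' b' c' x y z x' y' z'
    assume *: "a \<in> A" "a' \<in> A" "x \<in> A" "x' \<in> A"
      and eq: "f (a, b, c) = f (a', b', c')" "f (x, y, z) = f (x', y', z')"
      and "\<phi> ((a, b, c), (a', b', c')) = \<phi> ((x, y, z), (x', y', z'))"
    then have \<phi>: "a' / a = x' / x" "b - a' / a * b' = y - x' / x * y'" "a = x" "b' = y'" "c' = z'"
      by (auto simp: \<phi>_def)
    have "a > 0" using * A by auto
    with \<phi> have "a' = x'" by simp
    with \<phi> have "b = y" by simp
    have "x * (y + c) = x * (y + z)" using eq \<phi> \<open>a' = x'\<close> \<open>b = y\<close> by (simp add: f_def)
    with \<open>a > 0\<close> \<phi> have "c = z" by (metis add_left_cancel less_irrefl mult_cancel_left)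
    with \<phi> \<open>a' = x'\<close> \<open>b = y\<close>
    show "((a, b, c) = (x, y, z)) \<and> (a', b', c') = (x', y', z')" by simp
  qed
  moreover have "\<phi> ` {(s, t) \<in> (A \<times> B \<times> C) \<times> (A \<times> B \<times> C). f s = f t} \<subseteq> ?T"
  proof (rule image_subsetI, clarify)
    fix a b c a' b' c'
    assume *: "a \<in> A" "b \<in> B" "c \<in> C" "a' \<in> A" "b' \<in> B" "c' \<in> C" and eq: "f (a, b, c) = f (a', b', c')"
    have "a > 0" using * A by auto
    have r: "a' / a \<in> ratios A" using * by (auto simp: ratios_def)
    then have "b - a' / a * b' \<in> Z" using * by (force simp: Z_def)
    moreover have "b' \<in> line_hits B B (a' / a, b - a' / a * b')" using * by (simp add: line_hits_def)
    moreover have "a' / a * c' + - (b - a' / a * b') = c"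
      using eq \<open>a > 0\<close> by (simp add: f_def field_simps)
    then have "c' \<in> line_hits C C (a' / a, - (b - a' / a * b'))"
      using * by (simp only: line_hits_def fst_conv snd_conv mem_Collect_eq)
    ultimately show "\<phi> ((a, b, c), (a', b', c')) \<in> ?T"
      using r * \<open>a > 0\<close> by (simp add: \<phi>_def)
  qed
  ultimately have "card {(s, t) \<in> (A \<times> B \<times> C) \<times> (A \<times> B \<times> C). f s = f t} \<le> card ?T"
    using fin by (intro card_inj_on_le)
  also have "\<dots> = (\<Sum>z\<in>ratios A \<times> Z. card ({a \<in> A. fst z * a \<in> A} \<times> line_hits B B z \<times> line_hits C C (fst z, - snd z)))"
    using A B C by (intro card_SigmaI) (auto simp: Z_def)
  finally show ?thesis by (simp add: card_cartesian_product ratio_rep_def)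
qed

text \<open>Ratios are sorted by multiplicity. If \<Lambda> is the set of slopes of multiplicity at
  least 2^j, Cauchy-Schwarz and the second moments give a contribution of at most 2^j
  |\<Lambda>|^(1/2) (|B| |C|)^(3/2), up to logarithms. Since 2^j |\<Lambda>|^(1/2) is at most the
  root of the energy, the sizes of the levels disappear.\<close>

theorem card_mult_add_lower_bound:
  assumes A: "finite A" "\<And>a. a \<in> A \<Longrightarrow> a > 0" and B: "finite B" "B \<noteq> {}" and C: "finite C" "C \<noteq> {}"
    and small: "card (ratios A) \<le> (card B)\<^sup>2" "card (ratios A) \<le> (card C)\<^sup>2"
    and J: "card A < 2 ^ J" "card B < 2 ^ J" "card C < 2 ^ J"
  shows "real (card A) ^ 4 * real (card B) * real (card C)
    \<le> 10816 * real J ^ 4 * (real (card (A * (B + C))))\<^sup>2 * mult_energy A"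
proof -
  define a b c E where "a = real (card A)" and "b = real (card B)" and "c = real (card C)" and "E = mult_energy A"
  define f :: "real \<times> real \<times> real \<Rightarrow> real" where "f = (\<lambda>(a, b, c). a * (b + c))"
  define Z where "Z = (\<lambda>(l, b, b'). b - l * b') ` (ratios A \<times> B \<times> B)"
  define N where "N = real (card {(s, t) \<in> (A \<times> B \<times> C) \<times> (A \<times> B \<times> C). f s = f t})"
  define p q where "p z = real (card (line_hits B B z))" and "q z = real (card (line_hits C C (fst z, - snd z)))" for z
  have bc: "b > 0" "c > 0" using B C by (auto simp: b_def c_def card_gt_0_iff)
  have finZ: "finite Z" using A B by (simp add: Z_def)
  have level: "2 ^ j * (\<Sum>z | z \<in> ratios A \<times> Z \<and> 2 ^ j \<le> ratio_rep A (fst z). p z * q z)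
      \<le> 52 * real J * sqrt E * sqrt (b ^ 3 * c ^ 3)" for j
  proof -
    define \<Lambda> where "\<Lambda> = {l \<in> ratios A. 2 ^ j \<le> ratio_rep A l}"
    define s where "s = sqrt (real (card \<Lambda>))"
    have \<Lambda>: "finite \<Lambda>" "\<And>m. m \<in> \<Lambda> \<Longrightarrow> m > 0"
      using A ratios_pos[of _ A] by (auto simp: \<Lambda>_def)
    have "card \<Lambda> \<le> card (ratios A)" unfolding \<Lambda>_def using A by (intro card_mono) auto
    then have c\<Lambda>: "card \<Lambda> \<le> (card B)\<^sup>2" "card \<Lambda> \<le> (card C)\<^sup>2" using small by auto
    have P: "(\<Sum>z\<in>\<Lambda> \<times> Z. (p z)\<^sup>2) \<le> 52 * real J * s * b ^ 3"
      unfolding p_def s_def b_def by (rule sum_line_hits_square_le) (use \<Lambda> finZ B c\<Lambda> J in auto)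
    \<comment> \<open>Negating the intercepts turns this into a sum of the same kind as for
      \<open>p\<close>.\<close>
    have "(\<Sum>z\<in>\<Lambda> \<times> Z. (q z)\<^sup>2) = (\<Sum>z\<in>\<Lambda> \<times> uminus ` Z. (real (card (line_hits C C z)))\<^sup>2)"
      unfolding q_def
      by (rule sum.reindex_bij_witness[of _ "\<lambda>z. (fst z, - snd z)" "\<lambda>z. (fst z, - snd z)"]) auto
    also have "\<dots> \<le> 52 * real J * s * c ^ 3"
      unfolding s_def c_def by (rule sum_line_hits_square_le) (use \<Lambda> finZ C c\<Lambda> J in auto)
    finally have Q: "(\<Sum>z\<in>\<Lambda> \<times> Z. (q z)\<^sup>2) \<le> 52 * real J * s * c ^ 3" .
    have "(\<Sum>z\<in>\<Lambda> \<times> Z. p z * q z)\<^sup>2 \<le> (\<Sum>z\<in>\<Lambda> \<times> Z. (p z)\<^sup>2) * (\<Sum>z\<in>\<Lambda> \<times> Z. (q z)\<^sup>2)"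
      by (rule Cauchy_Schwarz_ineq_sum)
    also have "\<dots> \<le> (52 * real J * s * b ^ 3) * (52 * real J * s * c ^ 3)"
      using P Q bc by (intro mult_mono) (auto simp: s_def intro!: sum_nonneg mult_nonneg_nonneg)
    also have "\<dots> = (52 * real J * s * sqrt (b ^ 3 * c ^ 3))\<^sup>2"
      using bc by (simp add: power_mult_distrib) (simp add: power2_eq_square)
    finally have pq: "(\<Sum>z\<in>\<Lambda> \<times> Z. p z * q z) \<le> 52 * real J * s * sqrt (b ^ 3 * c ^ 3)"
      by (rule power2_le_imp_le) (use bc in \<open>auto simp: s_def\<close>)
    have "(2 ^ j * s)\<^sup>2 \<le> E"
      using level_card_le_energy[OF A(1), of "2 ^ j"] by (simp add: power_mult_distrib s_def E_def \<Lambda>_def)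
    then have s: "2 ^ j * s \<le> sqrt E" by (rule real_le_rsqrt)
    have "{z. z \<in> ratios A \<times> Z \<and> 2 ^ j \<le> ratio_rep A (fst z)} = \<Lambda> \<times> Z" by (auto simp: \<Lambda>_def)
    then have "2 ^ j * (\<Sum>z | z \<in> ratios A \<times> Z \<and> 2 ^ j \<le> ratio_rep A (fst z). p z * q z)
        \<le> 2 ^ j * (52 * real J * s * sqrt (b ^ 3 * c ^ 3))"
      using pq by simp
    also have "\<dots> = (52 * real J * sqrt (b ^ 3 * c ^ 3)) * (2 ^ j * s)" by simp
    also have "\<dots> \<le> (52 * real J * sqrt (b ^ 3 * c ^ 3)) * sqrt E"
      using s bc by (intro mult_left_mono) auto
    finally show ?thesis by (simp add: mult_ac)
  qed
  have "N \<le> real (\<Sum>z\<in>ratios A \<times> Z. ratio_rep A (fst z) *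
          (card (line_hits B B z) * card (line_hits C C (fst z, - snd z))))"
    unfolding N_def f_def Z_def by (intro of_nat_mono card_collisions_le A B C)
  also have "\<dots> = (\<Sum>z\<in>ratios A \<times> Z. real (ratio_rep A (fst z)) ^ 1 * (p z * q z))"
    by (simp add: p_def q_def)
  also have "\<dots> \<le> 2 ^ 1 * (\<Sum>j<J. (2 ^ j) ^ 1 * (\<Sum>z | z \<in> ratios A \<times> Z \<and> 2 ^ j \<le> ratio_rep A (fst z). p z * q z))"
    by (rule dyadic_sum_le)
      (use A finZ J ratio_rep_le[OF A(1)] in \<open>auto simp: p_def q_def intro: le_less_trans\<close>)
  also have "\<dots> \<le> 2 * (\<Sum>j<J. 52 * real J * sqrt E * sqrt (b ^ 3 * c ^ 3))"
    unfolding power_one_right by (intro mult_left_mono sum_mono level) auto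
  also have "\<dots> = 104 * real J ^ 2 * sqrt E * sqrt (b ^ 3 * c ^ 3)" by (simp add: power2_eq_square)
  finally have "N\<^sup>2 \<le> (104 * real J ^ 2 * sqrt E * sqrt (b ^ 3 * c ^ 3))\<^sup>2"
    by (intro power_mono) (auto simp: N_def)
  also have "\<dots> = 10816 * real J ^ 4 * E * (b ^ 3 * c ^ 3)"
    using bc mult_energy_nonneg[of A] by (simp add: power_mult_distrib E_def flip: power_mult)
  finally have N: "N\<^sup>2 \<le> 10816 * real J ^ 4 * E * (b ^ 3 * c ^ 3)" .
  define X where "X = real (card (A * (B + C)))"
  have im: "f ` (A \<times> B \<times> C) = A * (B + C)"
    by (force simp: f_def set_times_image set_plus_image)
  have "(a * b * c)\<^sup>2 \<le> X * N"
    using card_square_le_collisions[of "A \<times> B \<times> C" f] A B C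
    unfolding im X_def N_def a_def b_def c_def by (simp add: card_cartesian_product mult.assoc)
  \<comment> \<open>The bound on \<open>N\<close> contains the root of the energy, so the collision
    inequality is squared once more; b^3 c^3 then cancels.\<close>
  then have "((a * b * c)\<^sup>2)\<^sup>2 \<le> (X * N)\<^sup>2" by (intro power_mono) auto
  also have "\<dots> \<le> X\<^sup>2 * (10816 * real J ^ 4 * E * (b ^ 3 * c ^ 3))"
    using N by (simp add: power_mult_distrib mult_left_mono)
  finally have "(b ^ 3 * c ^ 3) * (a ^ 4 * b * c) \<le> (b ^ 3 * c ^ 3) * (10816 * real J ^ 4 * X\<^sup>2 * E)"
    by (simp add: eval_nat_numeral mult_ac)
  then show ?thesis
    using bc by (simp add: a_def b_def c_def X_def E_def)
qed

section \<open>Solymosi's bound of the multiplicative energy by the sumset\<close>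

lemma card_le_card_plus:
  fixes A B :: "real set"
  assumes "finite A" and "finite B" and "B \<noteq> {}"
  shows "card A \<le> card (A + B)"
proof -
  obtain b where "b \<in> B" using assms by auto
  then show ?thesis
    using assms by (intro card_inj_on_le[of "\<lambda>a. a + b"]) (auto simp: finite_set_plus)
qed

text \<open>Solymosi's argument: the vector sums of the points of \<open>A \<times> A\<close> on two neighbouring rich lines
  through the origin lie strictly between these lines, so different neighbouring pairs do not interfere.\<close>

lemma card_rich_ratios_le:
  assumes A: "finite A" "\<And>a. a \<in> A \<Longrightarrow> a > 0" and t: "t > 0"
  shows "t\<^sup>2 * card {l \<in> ratios A. t \<le> ratio_rep A l} \<le> 2 * (card (A + A))\<^sup>2"
proof (cases "{l \<in> ratios A. t \<le> ratio_rep A l} = {}")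
  case False
  define \<Lambda> where "\<Lambda> = {l \<in> ratios A. t \<le> ratio_rep A l}"
  \<comment> \<open>The steepest rich line has no next neighbour and is set aside.\<close>
  define \<Lambda>' where "\<Lambda>' = \<Lambda> - {Max \<Lambda>}"
  define \<sigma> where "\<sigma> l = Min {m \<in> \<Lambda>. l < m}" for l
  have fin: "finite \<Lambda>" and ne: "\<Lambda> \<noteq> {}" using A False by (auto simp: \<Lambda>_def)
  have \<sigma>: "\<sigma> l \<in> \<Lambda>" "l < \<sigma> l" if "l \<in> \<Lambda>'" for l
  proof -
    have "Max \<Lambda> \<in> {m \<in> \<Lambda>. l < m}"
      using that fin ne by (auto simp: \<Lambda>'_def order_less_le)
    then have "\<sigma> l \<in> {m \<in> \<Lambda>. l < m}" unfolding \<sigma>_def using fin by (intro Min_in) auto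
    then show "\<sigma> l \<in> \<Lambda>" "l < \<sigma> l" by auto
  qed
  have \<sigma>_le: "\<sigma> l \<le> m" if "m \<in> \<Lambda>" "l < m" for l m
    unfolding \<sigma>_def using that fin by (intro Min_le) auto
  define H where "H l = {a \<in> A. l * a \<in> A}" for l
  have finH: "finite (H l)" for l using A by (simp add: H_def)
  \<comment> \<open>The sum of the points (a, l a) and (b, \<sigma> l b) of
    \<open>A \<times> A\<close>; both of its coordinates lie in \<open>A + A\<close>.\<close>
  define F where "F = (\<lambda>(l, a, b). (a + b, l * a + \<sigma> l * b))"
  have between: "l * (a + b) < l * a + \<sigma> l * b" "l * a + \<sigma> l * b < \<sigma> l * (a + b)"
    if "l \<in> \<Lambda>'" "a \<in> H l" "b \<in> H (\<sigma> l)" for l a b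
  proof -
    have "0 < b * (\<sigma> l - l)" "0 < a * (\<sigma> l - l)" using \<sigma>[OF that(1)] A that by (auto simp: H_def)
    then show "l * (a + b) < l * a + \<sigma> l * b" "l * a + \<sigma> l * b < \<sigma> l * (a + b)"
      by (auto simp: algebra_simps)
  qed
  have not_less: "\<not> l < l'"
    if "l \<in> \<Lambda>'" "l' \<in> \<Lambda>'" "a \<in> H l" "b \<in> H (\<sigma> l)" "a' \<in> H l'" "b' \<in> H (\<sigma> l')" "F (l, a, b) = F (l', a', b')"
    for l l' a b a' b'
  proof
    assume "l < l'"
    then have "\<sigma> l \<le> l'" using \<sigma>_le that(2) by (auto simp: \<Lambda>'_def)
    moreover have "a + b > 0" using that A by (auto simp: H_def intro: add_pos_pos)
    ultimately have "\<sigma> l * (a + b) \<le> l' * (a + b)" by (intro mult_right_mono) auto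
    moreover have "a + b = a' + b'" "l * a + \<sigma> l * b = l' * a' + \<sigma> l' * b'" using that by (auto simp: F_def)
    ultimately show False using between(2)[of l a b] between(1)[of l' a' b'] that by simp
  qed
  have "inj_on F (SIGMA l : \<Lambda>'. H l \<times> H (\<sigma> l))"
  proof (rule inj_onI, clarify)
    fix l a b l' a' b'
    assume *: "l \<in> \<Lambda>'" "l' \<in> \<Lambda>'" "a \<in> H l" "b \<in> H (\<sigma> l)" "a' \<in> H l'" "b' \<in> H (\<sigma> l')" "F (l, a, b) = F (l', a', b')"
    have "l = l'" using not_less[OF *] not_less[OF *(2,1,5,6,3,4) *(7)[symmetric]] by simp
    with * have e: "a + b = a' + b'" "l * a + \<sigma> l * b = l * a' + \<sigma> l * b'" by (auto simp: F_def)
    have "(\<sigma> l - l) * (b - b') = (l * a + \<sigma> l * b) - (l * a' + \<sigma> l * b') - l * ((a + b) - (a' + b'))"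
      by (simp add: algebra_simps)
    also have "\<dots> = 0" unfolding e by simp
    finally have "(\<sigma> l - l) * (b - b') = 0" .
    with \<sigma>(2)[OF *(1)] e have "b = b'" "a = a'" by auto
    with \<open>l = l'\<close> show "l = l' \<and> (a, b) = (a', b')" by simp
  qed
  moreover have "F ` (SIGMA l : \<Lambda>'. H l \<times> H (\<sigma> l)) \<subseteq> (A + A) \<times> (A + A)"
    by (auto simp: F_def H_def)
  ultimately have "card (SIGMA l : \<Lambda>'. H l \<times> H (\<sigma> l)) \<le> card ((A + A) \<times> (A + A))"
    using A by (intro card_inj_on_le) (auto simp: finite_set_plus)
  moreover have "(\<Sum>l\<in>\<Lambda>'. t * t) \<le> (\<Sum>l\<in>\<Lambda>'. card (H l) * card (H (\<sigma> l)))"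
  proof (intro sum_mono mult_le_mono)
    fix l assume l: "l \<in> \<Lambda>'"
    then show "t \<le> card (H l)" by (auto simp: \<Lambda>'_def \<Lambda>_def H_def ratio_rep_def)
    show "t \<le> card (H (\<sigma> l))" using \<sigma>(1)[OF l] by (auto simp: \<Lambda>_def H_def ratio_rep_def)
  qed
  moreover have "card (SIGMA l : \<Lambda>'. H l \<times> H (\<sigma> l)) = (\<Sum>l\<in>\<Lambda>'. card (H l) * card (H (\<sigma> l)))"
    using fin finH by (simp add: \<Lambda>'_def card_cartesian_product)
  ultimately have 1: "t\<^sup>2 * card \<Lambda>' \<le> (card (A + A))\<^sup>2"
    by (simp add: card_cartesian_product power2_eq_square mult.commute)
  \<comment> \<open>The slope set aside costs another t^2 \<le> |A|^2 \<le> |A + A|^2, hence the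
    factor 2.\<close>
  obtain l where "l \<in> \<Lambda>" using ne by auto
  then have "t \<le> card A" using ratio_rep_le[OF A(1), of l] by (auto simp: \<Lambda>_def)
  moreover have "A \<noteq> {}" using \<open>t \<le> card A\<close> t by auto
  ultimately have "t \<le> card (A + A)" using card_le_card_plus[of A A] A by linarith
  then have "t\<^sup>2 \<le> (card (A + A))\<^sup>2" by (rule power_mono) simp
  moreover have "card \<Lambda> = card \<Lambda>' + 1"
    using fin ne card_Suc_Diff1[of \<Lambda> "Max \<Lambda>"] by (simp add: \<Lambda>'_def)
  then have "t\<^sup>2 * card \<Lambda> = t\<^sup>2 * card \<Lambda>' + t\<^sup>2" by simp
  ultimately show ?thesis using 1 unfolding \<Lambda>_def[symmetric] by linarith
next
  case True
  show ?thesis unfolding True by simp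
qed

lemma mult_energy_le_sumset:
  assumes A: "finite A" "\<And>a. a \<in> A \<Longrightarrow> a > 0" and J: "card A < 2 ^ J"
  shows "mult_energy A \<le> 8 * real J * (real (card (A + A)))\<^sup>2"
proof -
  have "(\<Sum>l\<in>ratios A. real (ratio_rep A l) ^ 2) \<le> 2 ^ 2 * real J * (2 * (real (card (A + A)))\<^sup>2)"
  proof (rule power_sum_le_dyadic)
    fix t :: nat assume "t > 0"
    then have "real (t\<^sup>2 * card {l \<in> ratios A. t \<le> ratio_rep A l}) \<le> real (2 * (card (A + A))\<^sup>2)"
      by (intro of_nat_mono card_rich_ratios_le A)
    then show "real t ^ 2 * real (card {l \<in> ratios A. t \<le> ratio_rep A l}) \<le> 2 * (real (card (A + A)))\<^sup>2"
      by simp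
  qed (use A J ratio_rep_le[OF A(1)] in \<open>auto intro: le_less_trans\<close>)
  then show ?thesis by (simp add: mult_energy_def)
qed

section \<open>Popular differences\<close>

definition diff_rep :: "real set \<Rightarrow> real set \<Rightarrow> real \<Rightarrow> nat" where
  "diff_rep V B x = card {b \<in> B. x + b \<in> V}"

definition difference_set :: "real set \<Rightarrow> real set \<Rightarrow> real set" where
  "difference_set V B = (\<lambda>(v, b). v - b) ` (V \<times> B)"

lemma finite_difference_set [simp]: "finite V \<Longrightarrow> finite B \<Longrightarrow> finite (difference_set V B)"
  by (simp add: difference_set_def)

lemma diff_in_difference_set: "v \<in> V \<Longrightarrow> b \<in> B \<Longrightarrow> v - b \<in> difference_set V B"
  by (auto simp: difference_set_def)

lemma diff_rep_le:
  assumes "finite V" and "finite B"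
  shows "diff_rep V B x \<le> card V" and "diff_rep V B x \<le> card B"
proof -
  show "diff_rep V B x \<le> card B" unfolding diff_rep_def using assms by (intro card_mono) auto
  show "diff_rep V B x \<le> card V"
    unfolding diff_rep_def using assms by (intro card_inj_on_le[of "\<lambda>b. x + b"]) (auto simp: inj_on_def)
qed

lemma sum_diff_rep_le:
  assumes "finite V" and "finite B"
  shows "(\<Sum>x\<in>difference_set V B. diff_rep V B x) \<le> card V * card B"
proof -
  have "(\<Sum>x\<in>difference_set V B. diff_rep V B x) = card (SIGMA x : difference_set V B. {b \<in> B. x + b \<in> V})"
    using assms by (simp add: diff_rep_def)
  also have "\<dots> \<le> card (V \<times> B)"
    using assms by (intro card_inj_on_le[of "\<lambda>(x, b). (x + b, b)"]) (auto simp: inj_on_def)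
  finally show ?thesis by (simp add: card_cartesian_product)
qed

text \<open>If the elements of \<open>V\<close> have many quotients in a small set \<open>P\<close>, then a popular difference
  \<open>x = v - b\<close> yields many points \<open>(x, p)\<close> on the lines \<open>p = (x + b) / a\<close>.\<close>

lemma card_popular_differences_le:
  assumes A: "finite A" "\<And>a. a \<in> A \<Longrightarrow> a > 0" and V: "V \<subseteq> A" and P: "finite P" and B: "finite B"
    and d: "0 \<le> d" "\<And>a. a \<in> V \<Longrightarrow> d \<le> real (card {a' \<in> A. a / a' \<in> P})" and s: "s > 0"
  shows "real s ^ 3 * real (card {x \<in> difference_set V B. s \<le> diff_rep V B x}) * d ^ 3
    \<le> 162 * (real (card A))\<^sup>2 * (real (card P))\<^sup>2 * (real (card B))\<^sup>2"
proof (cases "{x \<in> difference_set V B. s \<le> diff_rep V B x} = {}")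
  case True
  show ?thesis unfolding True by simp
next
  case False
  define X where "X = {x \<in> difference_set V B. s \<le> diff_rep V B x}"
  define n b p x where "n = real (card A)" and "b = real (card B)" and "p = real (card P)" and "x = real (card X)"
  have finV: "finite V" using A V finite_subset by blast
  have X: "finite X" using finV B by (simp add: X_def)
  have x: "x > 0" using X False by (auto simp: x_def X_def card_gt_0_iff)
  define \<phi> :: "real \<times> real \<Rightarrow> real \<times> real" where "\<phi> = (\<lambda>(a, b). (1 / a, b / a))"
  define L where "L = \<phi> ` (A \<times> B)"
  have inj: "inj_on \<phi> (A \<times> B)"
  proof (rule inj_onI, clarify)
    fix a b a' b' assume *: "a \<in> A" "a' \<in> A" "\<phi> (a, b) = \<phi> (a', b')"
    then have "a = a'" by (simp add: \<phi>_def)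
    with * A(2)[of a] show "a = a' \<and> b = b'" by (simp add: \<phi>_def)
  qed
  have cL: "real (card L) = n * b"
    using inj by (simp add: L_def card_image card_cartesian_product n_def b_def)
  define I where "I = (\<Sum>l\<in>L. real (card (line_hits X P l)))"
  \<comment> \<open>Each popular z has at least \<open>s\<close> shifts z + b in \<open>V\<close>,
    and each of these at least \<open>d\<close> divisors in \<open>A\<close> with quotient in
    \<open>P\<close>.\<close>
  have I: "x * real s * d \<le> I"
  proof -
    have "x * real s * d \<le> (\<Sum>z\<in>X. \<Sum>b\<in>B. real (card {a' \<in> A. (z + b) / a' \<in> P}))"
    proof -
      have "real s * d \<le> (\<Sum>b\<in>B. real (card {a' \<in> A. (z + b) / a' \<in> P}))" if "z \<in> X" for z
      proof -
        have "real s * d \<le> real (card {b \<in> B. z + b \<in> V}) * d"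
          using that d by (intro mult_right_mono) (auto simp: X_def diff_rep_def)
        also have "\<dots> = (\<Sum>b | b \<in> B \<and> z + b \<in> V. d)" by simp
        also have "\<dots> \<le> (\<Sum>b | b \<in> B \<and> z + b \<in> V. real (card {a' \<in> A. (z + b) / a' \<in> P}))"
          using d by (intro sum_mono) auto
        also have "\<dots> \<le> (\<Sum>b\<in>B. real (card {a' \<in> A. (z + b) / a' \<in> P}))"
          using B by (intro sum_mono2) auto
        finally show ?thesis .
      qed
      then have "(\<Sum>z\<in>X. real s * d) \<le> (\<Sum>z\<in>X. \<Sum>b\<in>B. real (card {a' \<in> A. (z + b) / a' \<in> P}))"
        by (intro sum_mono)
      then show ?thesis by (simp add: x_def mult.assoc)
    qed
    also have "\<dots> = (\<Sum>z\<in>X. \<Sum>b\<in>B. \<Sum>a'\<in>A. of_bool ((z + b) / a' \<in> P))"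
      using A by (simp add: Int_def)
    also have "\<dots> = (\<Sum>z\<in>X. \<Sum>a'\<in>A. \<Sum>b\<in>B. of_bool ((z + b) / a' \<in> P))"
      by (intro sum.cong refl sum.swap)
    also have "\<dots> = (\<Sum>a'\<in>A. \<Sum>z\<in>X. \<Sum>b\<in>B. of_bool ((z + b) / a' \<in> P))"
      by (rule sum.swap)
    also have "\<dots> = (\<Sum>a'\<in>A. \<Sum>b\<in>B. \<Sum>z\<in>X. of_bool ((z + b) / a' \<in> P))"
      by (intro sum.cong refl sum.swap)
    also have "\<dots> = (\<Sum>a'\<in>A. \<Sum>b\<in>B. real (card (line_hits X P (\<phi> (a', b)))))"
      using X by (simp add: line_hits_def \<phi>_def Int_def add_divide_distrib)
    also have "\<dots> = (\<Sum>z\<in>A \<times> B. real (card (line_hits X P (\<phi> z))))"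
      by (simp add: sum.cartesian_product case_prod_beta)
    also have "\<dots> = I" by (simp add: I_def L_def sum.reindex[OF inj])
    finally show ?thesis .
  qed
  have main: "real s ^ 3 * x * d ^ 3 \<le> 162 * n\<^sup>2 * p\<^sup>2 * b\<^sup>2"
  proof (cases "2 * real (card L) \<le> I")
    case True
    have "(x * real s * d) ^ 3 \<le> I ^ 3" using I x d by (intro power_mono) auto
    also have "\<dots> \<le> 162 * (real (card L))\<^sup>2 * (real (card X))\<^sup>2 * (real (card P))\<^sup>2"
      by (rule grid_szemeredi_trotter[OF X P _ _ I_def True]) (use A B in \<open>auto simp: L_def \<phi>_def\<close>)
    finally have "x\<^sup>2 * (real s ^ 3 * x * d ^ 3) \<le> x\<^sup>2 * (162 * n\<^sup>2 * p\<^sup>2 * b\<^sup>2)"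
      by (simp add: cL x_def p_def power_mult_distrib power2_eq_square power3_eq_cube mult_ac)
    then show ?thesis using x by (simp only: mult_le_cancel_left_pos zero_less_power)
  next
    \<comment> \<open>With fewer than two hits per line on average the incidence bound says nothing.
      But then x s d is at most 2 n b, and the trivial s^2 \<le> n b and d^2 \<le> p^2 supply the
      missing factors.\<close>
    case False
    then have 1: "x * real s * d \<le> 2 * (n * b)" using I cL by linarith
    obtain z where z: "z \<in> X" using x by (auto simp: x_def card_gt_0_iff)
    then have "s \<le> card V" "s \<le> card B"
      using diff_rep_le[OF finV B, of z] by (auto simp: X_def)
    moreover have "card V \<le> card A" using A V by (intro card_mono)
    ultimately have "real s \<le> n" "real s \<le> b" by (auto simp: n_def b_def)
    then have 2: "real s * real s \<le> n * b" by (intro mult_mono) (auto simp: n_def)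
    obtain w where w: "w \<in> V" using \<open>s \<le> card V\<close> s by fastforce
    have "card {a' \<in> A. w / a' \<in> P} \<le> card P"
    proof (rule card_inj_on_le)
      show "inj_on (\<lambda>a'. w / a') {a' \<in> A. w / a' \<in> P}"
        using A(2)[of w] V w by (force simp: inj_on_def)
    qed (use P in auto)
    then have "d \<le> p" using d(2)[OF w] by (simp add: p_def)
    then have 3: "d * d \<le> p * p" using d by (intro mult_mono) (auto simp: p_def)
    have "real s ^ 3 * x * d ^ 3 = (x * real s * d) * ((real s * real s) * (d * d))"
      by (simp add: power3_eq_cube mult_ac)
    also have "\<dots> \<le> (2 * (n * b)) * ((n * b) * (p * p))"
    proof (rule mult_mono[OF 1 mult_mono[OF 2 3]])
    qed (use x d in \<open>auto simp: n_def b_def\<close>)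
    also have "\<dots> = 2 * (n\<^sup>2 * p\<^sup>2 * b\<^sup>2)" by (simp add: power2_eq_square mult_ac)
    also have "\<dots> \<le> 162 * (n\<^sup>2 * p\<^sup>2 * b\<^sup>2)" by (intro mult_right_mono) auto
    finally show ?thesis by (simp add: mult.assoc)
  qed
  then show ?thesis by (simp add: X_def x_def n_def b_def p_def)
qed

section \<open>Additive energy, the Katz--Koester inclusion and third moments\<close>

lemma additive_energy_lower_bound:
  assumes V: "finite V"
  shows "real (card V) ^ 4 \<le> real (card (V + V)) * (\<Sum>x\<in>difference_set V V. (real (diff_rep V V x))\<^sup>2)"
proof -
  define f :: "real \<times> real \<Rightarrow> real" where "f = (\<lambda>(a, b). a + b)"
  define N where "N = {(s, t) \<in> (V \<times> V) \<times> (V \<times> V). f s = f t}"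
  define T where "T = (SIGMA x : difference_set V V. {b \<in> V. x + b \<in> V} \<times> {b \<in> V. x + b \<in> V})"
  have "card N \<le> card T"
  proof (rule card_inj_on_le)
    \<comment> \<open>A collision a + b = a' + b' means a - a' = b' - b: one difference with the two
      representations a' and b.\<close>
    show "inj_on (\<lambda>((a, b), (a', b')). (a - a', a', b)) N"
      by (auto simp: inj_on_def N_def f_def)
    show "(\<lambda>((a, b), (a', b')). (a - a', a', b)) ` N \<subseteq> T"
    proof (rule image_subsetI, clarify)
      fix a b a' b' assume *: "((a, b), (a', b')) \<in> N"
      then have "a - a' + b = b'" by (simp add: N_def f_def)
      with * show "(a - a', a', b) \<in> T" by (auto simp: N_def T_def diff_in_difference_set)
    qed
  qed (use V in \<open>simp add: T_def\<close>)
  also have "card T = (\<Sum>x\<in>difference_set V V. diff_rep V V x * diff_rep V V x)"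
    using V by (simp add: T_def card_cartesian_product diff_rep_def)
  finally have "real (card N) \<le> real (\<Sum>x\<in>difference_set V V. diff_rep V V x * diff_rep V V x)" by (rule of_nat_mono)
  then have N: "real (card N) \<le> (\<Sum>x\<in>difference_set V V. (real (diff_rep V V x))\<^sup>2)" by (simp add: power2_eq_square)
  have "(real (card (V \<times> V)))\<^sup>2 \<le> real (card (f ` (V \<times> V))) * real (card N)"
    unfolding N_def using V by (intro card_square_le_collisions) auto
  also have "f ` (V \<times> V) = V + V" by (simp add: f_def set_plus_image)
  also have "real (card (V + V)) * real (card N) \<le> real (card (V + V)) * (\<Sum>x\<in>difference_set V V. (real (diff_rep V V x))\<^sup>2)"
    using N by (intro mult_left_mono) auto
  finally show ?thesis by (simp add: card_cartesian_product eval_nat_numeral mult_ac)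
qed

text \<open>The Katz--Koester inclusion \<open>V + V\<^sub>x \<subseteq> (V + V) \<inter> (V + V - x)\<close>, where \<open>V\<^sub>x = V \<inter> (V - x)\<close>.\<close>

lemma katz_koester:
  assumes V: "finite V" and S: "finite S" "V + V \<subseteq> S"
  shows "(\<Sum>x\<in>difference_set V V. diff_rep V V x * card (V + {b \<in> V. x + b \<in> V})) \<le> (\<Sum>y\<in>difference_set V S. (diff_rep V S y)\<^sup>2)"
proof -
  define D where "D = (SIGMA x : difference_set V V. {b \<in> V. x + b \<in> V} \<times> (V + {b \<in> V. x + b \<in> V}))"
  define T where "T = (SIGMA y : difference_set V S. {s \<in> S. y + s \<in> V} \<times> {s \<in> S. y + s \<in> V})"
  have "card D \<le> card T"
  proof (rule card_inj_on_le)
    \<comment> \<open>The difference y = c - w has two representations, since y + w = c and y + (x +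
      w) = x + c lie in \<open>V\<close>; the inclusion puts w and x + w into
      \<open>S\<close>.\<close>
    show "inj_on (\<lambda>(x, c, w). (c - w, w, x + w)) D" by (auto simp: inj_on_def)
    show "(\<lambda>(x, c, w). (c - w, w, x + w)) ` D \<subseteq> T"
    proof (rule image_subsetI, clarify)
      fix x c w assume *: "(x, c, w) \<in> D"
      then obtain a b where ab: "a \<in> V" "b \<in> V" "x + b \<in> V" "w = a + b"
        by (auto simp: D_def elim: set_plus_elim)
      have "w \<in> S" using ab S by auto
      moreover have "a + (x + b) \<in> S" using ab S by blast
      then have "x + w \<in> S" using ab by (simp add: algebra_simps)
      moreover have "c \<in> V" "x + c \<in> V" using * by (auto simp: D_def)
      ultimately show "(c - w, w, x + w) \<in> T"
        by (auto simp: T_def diff_in_difference_set algebra_simps)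
    qed
  qed (use V S in \<open>simp add: T_def\<close>)
  also have "card T = (\<Sum>y\<in>difference_set V S. (diff_rep V S y)\<^sup>2)"
    using V S by (simp add: T_def card_cartesian_product diff_rep_def power2_eq_square)
  also have "card D = (\<Sum>x\<in>difference_set V V. diff_rep V V x * card (V + {b \<in> V. x + b \<in> V}))"
    using V by (simp add: D_def card_cartesian_product diff_rep_def finite_set_plus)
  finally show ?thesis .
qed

text \<open>In a collision a + b = a' + b' of \<open>V\<close> with the slice at x, the difference z
  = a - a' is represented three times, by a', by b and by x + b, because z + b = b' and z + (x + b)
  = x + b'. These data recover x and the collision, hence the cube.\<close>

lemma sum_popular_energy_le:
  assumes V: "finite V" and T: "T \<subseteq> difference_set V V"
  shows "(\<Sum>x\<in>T. card {(s, t) \<in> (V \<times> {b \<in> V. x + b \<in> V}) \<times> (V \<times> {b \<in> V. x + b \<in> V}). fst s + snd s = fst t + snd t})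
    \<le> (\<Sum>x\<in>difference_set V V. diff_rep V V x ^ 3)"
proof -
  define N where "N x = {(s, t) \<in> (V \<times> {b \<in> V. x + b \<in> V}) \<times> (V \<times> {b \<in> V. x + b \<in> V}). fst s + snd s = fst t + snd t}" for x
  define H where "H z = {b \<in> V. z + b \<in> V}" for z
  define U where "U = (SIGMA z : difference_set V V. H z \<times> H z \<times> H z)"
  have finT: "finite T" using T V finite_subset finite_difference_set by metis
  have finN: "finite (N x)" for x
    by (rule finite_subset[of _ "(V \<times> V) \<times> (V \<times> V)"]) (use V in \<open>auto simp: N_def\<close>)
  have finH: "finite (H z)" for z using V by (simp add: H_def)
  have "card (SIGMA x : T. N x) \<le> card U"
  proof (rule card_inj_on_le)
    show "inj_on (\<lambda>(x, (a, b), (a', b')). (a - a', a', b, x + b)) (SIGMA x : T. N x)"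
      by (auto simp: inj_on_def N_def)
    show "(\<lambda>(x, (a, b), (a', b')). (a - a', a', b, x + b)) ` (SIGMA x : T. N x) \<subseteq> U"
    proof (rule image_subsetI, clarify)
      fix x a b a' b' assume *: "((a, b), (a', b')) \<in> N x"
      then have "a - a' + b = b'" "a - a' + (x + b) = x + b'" "a - a' + a' = a" by (auto simp: N_def)
      moreover have "b' \<in> V" "x + b' \<in> V" "a \<in> V" "a' \<in> V" "b \<in> V" "x + b \<in> V" using * by (auto simp: N_def)
      ultimately show "(a - a', a', b, x + b) \<in> U"
        unfolding U_def H_def by (simp only: mem_Sigma_iff mem_Collect_eq diff_in_difference_set simp_thms)
    qed
  qed (use V finH in \<open>simp add: U_def\<close>)
  also have "card U = (\<Sum>x\<in>difference_set V V. diff_rep V V x ^ 3)"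
    using V finH by (simp add: U_def card_cartesian_product power3_eq_cube) (simp add: H_def diff_rep_def mult.assoc)
  finally show ?thesis using finT finN by (simp add: N_def)
qed

text \<open>The third moment of \<open>r(x) = diff_rep V V x\<close> controls the energies between \<open>V\<close> and its slices
  \<open>V\<^sub>x\<close>. Hence \<open>V + V\<^sub>x\<close> is large for popular \<open>x\<close>, while Katz--Koester bounds the sizes of these sumsets
  by the energy between \<open>V\<close> and \<open>S\<close>.\<close>

lemma few_popular_differences_imp_large_sumset:
  assumes V: "finite V" "V \<noteq> {}" and S: "finite S" "V + V \<subseteq> S" and J: "card V < 2 ^ J" and Q: "0 \<le> Q"
    and few: "\<And>B s. finite B \<Longrightarrow> s > 0 \<Longrightarrow>
      real s ^ 3 * real (card {x \<in> difference_set V B. s \<le> diff_rep V B x}) \<le> Q * (real (card B))\<^sup>2"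
  shows "real (card V) ^ 19 \<le> 2 ^ 22 * real J ^ 10 * Q ^ 5 * real (card S) ^ 9"
proof -
  define v \<sigma> where "v = real (card V)" and "\<sigma> = real (card S)"
  define D where "D = difference_set V V"
  define r where "r x = diff_rep V V x" for x
  define E2 E3 ES where "E2 = (\<Sum>x\<in>D. real (r x) ^ 2)" and "E3 = (\<Sum>x\<in>D. real (r x) ^ 3)"
    and "ES = (\<Sum>y\<in>difference_set V S. real (diff_rep V S y) ^ 2)"
  define H where "H x = {b \<in> V. x + b \<in> V}" for x
  have finD: "finite D" using V by (simp add: D_def)
  have rH: "r x = card (H x)" for x by (simp add: r_def H_def diff_rep_def)
  have v: "v > 0" using V by (simp add: v_def card_gt_0_iff)
  have "J > 0" using J V by (cases J) (auto simp: card_gt_0_iff)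
  have nonneg: "0 \<le> E3" "0 \<le> ES" "0 \<le> \<sigma>" by (auto simp: E3_def ES_def \<sigma>_def intro!: sum_nonneg)
  have rJ: "diff_rep V B x < 2 ^ J" if "finite B" for B x
    using diff_rep_le(1)[OF V(1) that, of x] J by linarith
  have E3: "E3 \<le> 8 * real J * (Q * v\<^sup>2)"
  proof -
    have "E3 \<le> 2 ^ 3 * real J * (Q * v\<^sup>2)"
      unfolding E3_def D_def r_def v_def by (rule power_sum_le_dyadic) (use V rJ few in auto)
    then show ?thesis by simp
  qed
  have ES: "ES\<^sup>2 \<le> 16 * (real J)\<^sup>2 * (Q * v * \<sigma> ^ 3)"
  proof -
    have "ES \<le> 2 ^ 2 * real J * sqrt (Q * v * \<sigma> ^ 3)"
      unfolding ES_def
    proof (rule power_sum_le_dyadic)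
      fix s :: nat assume "s > 0"
      define k where "k = real (card {y \<in> difference_set V S. s \<le> diff_rep V S y})"
      have "s * card {y \<in> difference_set V S. s \<le> diff_rep V S y} \<le> card V * card S"
        using level_card_le_sum[of "difference_set V S" s "diff_rep V S"] sum_diff_rep_le[of V S] V S by simp
      then have "real (s * card {y \<in> difference_set V S. s \<le> diff_rep V S y}) \<le> real (card V * card S)"
        by (rule of_nat_mono)
      then have 1: "real s * k \<le> v * \<sigma>" by (simp add: k_def v_def \<sigma>_def)
      have 2: "real s ^ 3 * k \<le> Q * \<sigma>\<^sup>2" unfolding k_def \<sigma>_def using few[OF S(1) \<open>s > 0\<close>] .
      \<comment> \<open>Double counting controls the first moment and \<open>Q\<close> the third;
        the second is their geometric mean.\<close>
      have "(real s ^ 2 * k)\<^sup>2 = (real s * k) * (real s ^ 3 * k)"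
        by (simp add: power2_eq_square power3_eq_cube mult_ac)
      also have "\<dots> \<le> (v * \<sigma>) * (Q * \<sigma>\<^sup>2)"
        by (rule mult_mono[OF 1 2]) (auto simp: k_def v_def \<sigma>_def)
      also have "\<dots> = Q * v * \<sigma> ^ 3" by (simp add: power2_eq_square power3_eq_cube mult_ac)
      finally show "real s ^ 2 * real (card {y \<in> difference_set V S. s \<le> diff_rep V S y}) \<le> sqrt (Q * v * \<sigma> ^ 3)"
        unfolding k_def by (rule real_le_rsqrt)
    qed (use V S rJ in auto)
    then have "ES\<^sup>2 \<le> (2 ^ 2 * real J * sqrt (Q * v * \<sigma> ^ 3))\<^sup>2" using nonneg by (intro power_mono) auto
    then show ?thesis using Q v nonneg by (simp add: power_mult_distrib)
  qed
  \<comment> \<open>The differences of popularity at least \<tau> carry the additive energy up to a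
    factor \<open>4 * J\<close>.\<close>
  obtain \<tau> where \<tau>: "\<tau> > 0" "E2 \<le> 2 ^ 2 * real J * (real \<tau> ^ 2 * real (card {x \<in> D. \<tau> \<le> r x}))"
    unfolding E2_def
    by (rule obtain_dyadic_level[of D r J 2]) (use V finD rJ \<open>J > 0\<close> in \<open>auto simp: r_def\<close>)
  define T k where "T = {x \<in> D. \<tau> \<le> r x}" and "k = real (card T)"
  have finT: "finite T" using finD by (simp add: T_def)
  define e where "e x = real (card {(s, t) \<in> (V \<times> H x) \<times> (V \<times> H x). fst s + snd s = fst t + snd t})" for x
  define w where "w x = real (card (V + H x))" for x
  have slice: "v * real (r x) \<le> sqrt (w x) * sqrt (e x)" for x
  proof -
    have "(\<lambda>s. fst s + snd s) ` (V \<times> H x) = V + H x" by (simp add: set_plus_image case_prod_beta)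
    then have "(v * real (r x))\<^sup>2 \<le> w x * e x"
      using card_square_le_collisions[of "V \<times> H x" "\<lambda>s. fst s + snd s"] V
      by (simp add: card_cartesian_product v_def rH w_def e_def H_def)
    then show ?thesis by (simp add: real_le_rsqrt flip: real_sqrt_mult)
  qed
  have e: "(\<Sum>x\<in>T. e x) \<le> E3"
  proof -
    have "real (\<Sum>x\<in>T. card {(s, t) \<in> (V \<times> H x) \<times> (V \<times> H x). fst s + snd s = fst t + snd t}) \<le> real (\<Sum>x\<in>D. r x ^ 3)"
      unfolding H_def D_def r_def
      by (intro of_nat_mono sum_popular_energy_le V) (auto simp: T_def D_def)
    then show ?thesis by (simp add: e_def E3_def)
  qed
  have w: "real \<tau> * (\<Sum>x\<in>T. w x) \<le> ES"
  proof -
    have "real \<tau> * (\<Sum>x\<in>T. w x) \<le> (\<Sum>x\<in>T. real (r x) * w x)"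
      unfolding sum_distrib_left by (intro sum_mono mult_right_mono) (auto simp: T_def w_def)
    also have "\<dots> \<le> (\<Sum>x\<in>D. real (r x) * w x)"
      using finD by (intro sum_mono2) (auto simp: T_def w_def)
    also have "\<dots> = real (\<Sum>x\<in>D. r x * card (V + H x))" by (simp add: w_def)
    also have "\<dots> \<le> real (\<Sum>y\<in>difference_set V S. (diff_rep V S y)\<^sup>2)"
      unfolding D_def r_def H_def by (intro of_nat_mono katz_koester V S)
    finally show ?thesis by (simp add: ES_def)
  qed
  have T1: "v * (real \<tau> * k) \<le> (\<Sum>x\<in>T. sqrt (w x) * sqrt (e x))"
  proof -
    have "v * (real \<tau> * k) = (\<Sum>x\<in>T. v * real \<tau>)" by (simp add: k_def mult_ac)
    also have "\<dots> \<le> (\<Sum>x\<in>T. v * real (r x))"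
      using v by (intro sum_mono mult_left_mono) (auto simp: T_def)
    also have "\<dots> \<le> (\<Sum>x\<in>T. sqrt (w x) * sqrt (e x))" by (intro sum_mono slice)
    finally show ?thesis .
  qed
  \<comment> \<open>Cauchy-Schwarz over \<open>T\<close> separates the sumset sizes from the slice
    energies. A further factor \<tau> then matches the weight \<open>r x\<close> in the
    Katz--Koester sum.\<close>
  have "(v * (real \<tau> * k))\<^sup>2 \<le> (\<Sum>x\<in>T. sqrt (w x) * sqrt (e x))\<^sup>2"
    using T1 v by (intro power_mono) (auto simp: k_def)
  also have "\<dots> \<le> (\<Sum>x\<in>T. (sqrt (w x))\<^sup>2) * (\<Sum>x\<in>T. (sqrt (e x))\<^sup>2)"
    by (rule Cauchy_Schwarz_ineq_sum)
  also have "\<dots> = (\<Sum>x\<in>T. w x) * (\<Sum>x\<in>T. e x)" by (simp add: w_def e_def)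
  finally have "real \<tau> * (v * (real \<tau> * k))\<^sup>2 \<le> real \<tau> * ((\<Sum>x\<in>T. w x) * (\<Sum>x\<in>T. e x))"
    by (intro mult_left_mono) auto
  also have "\<dots> \<le> ES * E3"
    unfolding mult.assoc[symmetric]
    by (rule mult_mono[OF w e]) (auto simp: ES_def e_def intro!: sum_nonneg)
  finally have T2: "v\<^sup>2 * (real \<tau> ^ 3 * k\<^sup>2) \<le> ES * E3"
    by (simp add: power2_eq_square power3_eq_cube mult_ac)
  have T3: "real \<tau> ^ 3 * k \<le> Q * v\<^sup>2"
    unfolding k_def v_def T_def D_def r_def using few[OF V(1) \<tau>(1)] .
  \<comment> \<open>Multiplying by \<tau>^3 k produces a power of \<tau>^2 k, the very quantity that
    bounds \<open>E2\<close>, so \<tau> and k need no separate control.\<close>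
  have "v\<^sup>2 * (real \<tau> ^ 2 * k) ^ 3 = (v\<^sup>2 * (real \<tau> ^ 3 * k\<^sup>2)) * (real \<tau> ^ 3 * k)"
    by (simp add: power2_eq_square power3_eq_cube mult_ac)
  also have "\<dots> \<le> (ES * E3) * (Q * v\<^sup>2)"
    by (rule mult_mono[OF T2 T3]) (use nonneg in \<open>auto simp: k_def\<close>)
  also have "\<dots> \<le> (ES * (8 * real J * (Q * v\<^sup>2))) * (Q * v\<^sup>2)"
    using E3 nonneg Q by (intro mult_right_mono mult_left_mono) auto
  finally have "v\<^sup>2 * (real \<tau> ^ 2 * k) ^ 3 \<le> v\<^sup>2 * (8 * real J * Q\<^sup>2 * ES * v\<^sup>2)"
    by (simp add: power2_eq_square mult_ac)
  then have T4: "(real \<tau> ^ 2 * k) ^ 3 \<le> 8 * real J * Q\<^sup>2 * ES * v\<^sup>2"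
    using v by (simp only: mult_le_cancel_left_pos zero_less_power)
  have "v ^ 4 \<le> \<sigma> * E2"
  proof -
    have "card (V + V) \<le> card S" using S by (intro card_mono)
    then have "real (card (V + V)) * E2 \<le> \<sigma> * E2"
      by (intro mult_right_mono) (auto simp: \<sigma>_def E2_def intro!: sum_nonneg)
    then show ?thesis
      using additive_energy_lower_bound[OF V(1)] by (simp add: v_def E2_def D_def r_def)
  qed
  also have "\<dots> \<le> \<sigma> * (4 * real J * (real \<tau> ^ 2 * k))"
    using \<tau>(2) nonneg by (intro mult_left_mono) (auto simp: k_def T_def)
  finally have "(v ^ 4) ^ 3 \<le> (\<sigma> * (4 * real J * (real \<tau> ^ 2 * k))) ^ 3"
    using v by (intro power_mono) auto
  also have "\<dots> = 64 * real J ^ 3 * \<sigma> ^ 3 * (real \<tau> ^ 2 * k) ^ 3"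
    by (simp add: power_mult_distrib)
  also have "\<dots> \<le> 64 * real J ^ 3 * \<sigma> ^ 3 * (8 * real J * Q\<^sup>2 * ES * v\<^sup>2)"
    using T4 nonneg by (intro mult_left_mono) auto
  finally have "v\<^sup>2 * v ^ 10 \<le> v\<^sup>2 * (512 * real J ^ 4 * \<sigma> ^ 3 * Q\<^sup>2 * ES)"
    by (simp add: eval_nat_numeral mult_ac)
  then have "v ^ 10 \<le> 512 * real J ^ 4 * \<sigma> ^ 3 * Q\<^sup>2 * ES"
    using v by (simp only: mult_le_cancel_left_pos zero_less_power)
  \<comment> \<open>\<open>ES\<close> is bounded through its square. Squaring gives v^20 with one
    \<open>v\<close> on the right, which leaves v^19.\<close>
  then have "(v ^ 10)\<^sup>2 \<le> (512 * real J ^ 4 * \<sigma> ^ 3 * Q\<^sup>2 * ES)\<^sup>2"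
    using v by (intro power_mono) auto
  also have "\<dots> = (512 * real J ^ 4 * \<sigma> ^ 3 * Q\<^sup>2)\<^sup>2 * ES\<^sup>2" by (simp only: power_mult_distrib)
  also have "\<dots> \<le> (512 * real J ^ 4 * \<sigma> ^ 3 * Q\<^sup>2)\<^sup>2 * (16 * (real J)\<^sup>2 * (Q * v * \<sigma> ^ 3))"
    using ES by (intro mult_left_mono) auto
  finally have "v * v ^ 19 \<le> v * (2 ^ 22 * real J ^ 10 * Q ^ 5 * \<sigma> ^ 9)"
    by (simp add: eval_nat_numeral mult_ac)
  then show ?thesis using v by (simp add: v_def \<sigma>_def)
qed

section \<open>Large multiplicative energy forces a large sumset\<close>

lemma sum_quotients_ge:
  assumes A: "finite A" "\<And>a. a \<in> A \<Longrightarrow> a > 0" and P: "finite P"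
    and t: "\<And>l. l \<in> P \<Longrightarrow> t \<le> ratio_rep A l"
  shows "t * card P \<le> (\<Sum>a\<in>A. card {a' \<in> A. a / a' \<in> P})"
proof -
  have "t * card P = (\<Sum>l\<in>P. t)" by simp
  also have "\<dots> \<le> (\<Sum>l\<in>P. ratio_rep A l)" by (intro sum_mono t)
  also have "\<dots> = card (SIGMA l : P. {a \<in> A. l * a \<in> A})"
    using A P by (simp add: ratio_rep_def)
  also have "\<dots> \<le> card (SIGMA a : A. {a' \<in> A. a / a' \<in> P})"
  proof (rule card_inj_on_le)
    have pos: "a \<noteq> 0" if "a \<in> A" for a using A(2)[OF that] by simp
    show "inj_on (\<lambda>(l, a). (l * a, a)) (SIGMA l : P. {a \<in> A. l * a \<in> A})"
      using pos by (auto simp: inj_on_def)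
    show "(\<lambda>(l, a). (l * a, a)) ` (SIGMA l : P. {a \<in> A. l * a \<in> A}) \<subseteq> (SIGMA a : A. {a' \<in> A. a / a' \<in> P})"
      using pos by auto
  qed (use A in auto)
  also have "\<dots> = (\<Sum>a\<in>A. card {a' \<in> A. a / a' \<in> P})" using A by simp
  finally show ?thesis .
qed

lemma mult_energy_pos:
  assumes "finite A" and "A \<noteq> {}" and "\<And>a. a \<in> A \<Longrightarrow> a > 0"
  shows "0 < mult_energy A"
proof -
  obtain a where a: "a \<in> A" using assms by auto
  then have "a / a = 1" using assms(3)[of a] by simp
  then have "1 \<in> ratios A"
    unfolding ratios_def using a by (intro image_eqI[of _ _ "(a, a)"]) auto
  moreover have "ratio_rep A 1 > 0" using a assms(1) by (auto simp: ratio_rep_def card_gt_0_iff)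
  ultimately show ?thesis
    unfolding mult_energy_def using assms(1) by (intro sum_pos2[of _ 1]) auto
qed

text \<open>The energy is essentially t^2 p, with p ratios of multiplicity at least t, and an
  average element of \<open>A\<close> has at least t p / n quotients among them. The elements with
  at least half of that form \<open>V\<close>. Substituting d = t p / (2 n) into the bounds for
  \<open>V\<close> gives t^34 p^24 \<le> n^44 |A + A|^9 up to constants and logarithms. The power 24
  of the energy is dictated by p^24, and the remaining t^14 is estimated by n^14.\<close>

theorem mult_energy_power_le_sumset:
  assumes A: "finite A" "A \<noteq> {}" "\<And>a. a \<in> A \<Longrightarrow> a > 0" and J: "card A < 2 ^ J"
  shows "mult_energy A ^ 24 \<le> 4 ^ 24 * 2 ^ 56 * 162 ^ 5 * real J ^ 34 * real (card A) ^ 58 * real (card (A + A)) ^ 9"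
proof -
  define n \<sigma> where "n = real (card A)" and "\<sigma> = real (card (A + A))"
  have n: "n > 0" using A by (simp add: n_def card_gt_0_iff)
  have "J > 0" using J A by (cases J) (auto simp: card_gt_0_iff)
  obtain t where t: "t > 0"
    "mult_energy A \<le> 2 ^ 2 * real J * (real t ^ 2 * real (card {l \<in> ratios A. t \<le> ratio_rep A l}))"
    unfolding mult_energy_def
    by (rule obtain_dyadic_level[of "ratios A" "ratio_rep A" J 2])
      (use A J ratio_rep_le[OF A(1)] \<open>J > 0\<close> in \<open>auto intro: le_less_trans\<close>)
  define P p where "P = {l \<in> ratios A. t \<le> ratio_rep A l}" and "p = real (card P)"
  have P: "finite P" using A by (simp add: P_def)
  have Pt: "t \<le> ratio_rep A l" if "l \<in> P" for l using that unfolding P_def by blast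
  have "p \<noteq> 0"
  proof
    assume "p = 0"
    then have "mult_energy A \<le> 0" using t(2) unfolding P_def[symmetric] p_def[symmetric] by simp
    then show False using mult_energy_pos[OF A] by simp
  qed
  then have p: "p > 0" by (simp add: p_def)
  then obtain l where "l \<in> P" by (auto simp: p_def card_gt_0_iff)
  then have "t \<le> card A" using ratio_rep_le[OF A(1), of l] by (simp add: P_def)
  then have tn: "real t \<le> n" by (simp add: n_def)
  define \<delta> where "\<delta> a = real (card {a' \<in> A. a / a' \<in> P})" for a
  define d where "d = real t * p / (2 * n)"
  have d: "d > 0" using t p n by (simp add: d_def)
  define V where "V = {a \<in> A. d \<le> \<delta> a}"
  have finV: "finite V" and VA: "V \<subseteq> A" using A by (auto simp: V_def)
  \<comment> \<open>Elements outside \<open>V\<close> account for at most n d = t p / 2 quotients,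
    those in \<open>V\<close> for at most n each. So \<open>d\<close> is at once the threshold
    defining \<open>V\<close> and a lower bound for its size.\<close>
  have Vd: "d \<le> real (card V)"
  proof -
    have "real (t * card P) \<le> real (\<Sum>a\<in>A. card {a' \<in> A. a / a' \<in> P})"
      by (intro of_nat_mono sum_quotients_ge A P Pt)
    then have "real t * p \<le> (\<Sum>a\<in>A. \<delta> a)" by (simp add: p_def \<delta>_def)
    also have "\<dots> = (\<Sum>a\<in>V. \<delta> a) + (\<Sum>a\<in>A - V. \<delta> a)"
      using sum.subset_diff[OF VA A(1), of \<delta>] by simp
    also have "\<dots> \<le> (\<Sum>a\<in>V. n) + (\<Sum>a\<in>A - V. d)"
    proof (intro add_mono sum_mono)
      show "\<delta> a \<le> n" for a unfolding \<delta>_def n_def using A by (intro of_nat_mono card_mono) auto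
    qed (auto simp: V_def)
    also have "\<dots> \<le> real (card V) * n + n * d"
      using card_mono[of A "A - V"] A d by (auto simp: n_def intro!: mult_right_mono)
    also have "n * d = real t * p / 2" using n by (simp add: d_def)
    finally have "real t * p / 2 \<le> real (card V) * n" by simp
    then show ?thesis using n by (simp add: d_def field_simps)
  qed
  define Q where "Q = 162 * n\<^sup>2 * p\<^sup>2 / d ^ 3"
  have "real (card V) ^ 19 \<le> 2 ^ 22 * real J ^ 10 * Q ^ 5 * \<sigma> ^ 9"
    unfolding \<sigma>_def
  proof (rule few_popular_differences_imp_large_sumset)
    show "V \<noteq> {}" using Vd d by auto
    show "finite (A + A)" using A by (simp add: finite_set_plus)
    show "V + V \<subseteq> A + A" using VA by (intro set_plus_mono2)
    show "card V < 2 ^ J" using card_mono[OF A(1) VA] J by simp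
    show "0 \<le> Q" using d by (simp add: Q_def)
    fix B :: "real set" and s :: nat
    assume "finite B" "s > 0"
    then have "real s ^ 3 * real (card {x \<in> difference_set V B. s \<le> diff_rep V B x}) * d ^ 3
        \<le> 162 * n\<^sup>2 * p\<^sup>2 * (real (card B))\<^sup>2"
      unfolding n_def p_def
      by (intro card_popular_differences_le A VA P) (use d in \<open>auto simp: V_def \<delta>_def\<close>)
    then show "real s ^ 3 * real (card {x \<in> difference_set V B. s \<le> diff_rep V B x}) \<le> Q * (real (card B))\<^sup>2"
      using d by (simp add: Q_def field_simps)
  qed (rule finV)
  then have "d ^ 19 \<le> 2 ^ 22 * real J ^ 10 * Q ^ 5 * \<sigma> ^ 9"
    using power_mono[OF Vd, of 19] d by linarith
  \<comment> \<open>The factor d^15 clears the denominator of \<open>Q ^ 5\<close>.\<close>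
  then have d19: "d ^ 19 * d ^ 15 \<le> 2 ^ 22 * real J ^ 10 * Q ^ 5 * \<sigma> ^ 9 * d ^ 15"
    by (rule mult_right_mono) (use d in simp)
  have "Q * d ^ 3 = 162 * n\<^sup>2 * p\<^sup>2" using d by (simp add: Q_def)
  then have "(Q * d ^ 3) ^ 5 = (162 * n\<^sup>2 * p\<^sup>2) ^ 5" by simp
  then have Qd: "Q ^ 5 * d ^ 15 = 162 ^ 5 * n ^ 10 * p ^ 10"
    unfolding power_mult_distrib power_mult[symmetric] by simp
  have "d ^ 34 = d ^ 19 * d ^ 15" by (simp flip: power_add)
  also note d19
  also have "2 ^ 22 * real J ^ 10 * Q ^ 5 * \<sigma> ^ 9 * d ^ 15 = 2 ^ 22 * real J ^ 10 * \<sigma> ^ 9 * (Q ^ 5 * d ^ 15)"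
    by (simp only: mult_ac)
  finally have d34: "d ^ 34 \<le> 2 ^ 22 * real J ^ 10 * \<sigma> ^ 9 * (162 ^ 5 * n ^ 10 * p ^ 10)"
    unfolding Qd .
  have "2 * n * d = real t * p" using n by (simp add: d_def)
  then have "(2 * n * d) ^ 34 = (real t * p) ^ 34" by simp
  then have "p ^ 10 * (real t ^ 34 * p ^ 24) = (2 * n) ^ 34 * d ^ 34"
    unfolding power_mult_distrib by (simp add: mult.left_commute flip: power_add)
  also have "\<dots> \<le> (2 * n) ^ 34 * (2 ^ 22 * real J ^ 10 * \<sigma> ^ 9 * (162 ^ 5 * n ^ 10 * p ^ 10))"
    by (rule mult_left_mono[OF d34]) (use n in simp)
  also have "\<dots> = p ^ 10 * ((2 ^ 34 * 2 ^ 22) * 162 ^ 5 * real J ^ 10 * (n ^ 34 * n ^ 10) * \<sigma> ^ 9)"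
    by (simp only: power_mult_distrib mult_ac)
  also have "\<dots> = p ^ 10 * (2 ^ 56 * 162 ^ 5 * real J ^ 10 * n ^ 44 * \<sigma> ^ 9)"
    unfolding power_add[symmetric] by simp
  finally have "p ^ 10 * (real t ^ 34 * p ^ 24) \<le> p ^ 10 * (2 ^ 56 * 162 ^ 5 * real J ^ 10 * n ^ 44 * \<sigma> ^ 9)" .
  then have tp: "real t ^ 34 * p ^ 24 \<le> 2 ^ 56 * 162 ^ 5 * real J ^ 10 * n ^ 44 * \<sigma> ^ 9"
    using p by (simp only: mult_le_cancel_left_pos zero_less_power)
  have "mult_energy A ^ 24 \<le> (4 * real J * (real t ^ 2 * p)) ^ 24"
    using t(2) mult_energy_nonneg[of A] by (intro power_mono) (auto simp: p_def P_def)
  also have "\<dots> = 4 ^ 24 * real J ^ 24 * (real t ^ 14 * (real t ^ 34 * p ^ 24))"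
    by (simp only: power_mult_distrib mult.assoc flip: power_mult power_add) (simp flip: power_add mult.assoc)
  also have "\<dots> \<le> 4 ^ 24 * real J ^ 24 * (n ^ 14 * (2 ^ 56 * 162 ^ 5 * real J ^ 10 * n ^ 44 * \<sigma> ^ 9))"
    by (intro mult_left_mono mult_mono[OF power_mono[OF tn] tp]) (use n p in auto)
  also have "\<dots> = 4 ^ 24 * 2 ^ 56 * 162 ^ 5 * (real J ^ 24 * real J ^ 10) * (n ^ 14 * n ^ 44) * \<sigma> ^ 9"
    by (simp only: mult_ac)
  finally show ?thesis unfolding power_add[symmetric] n_def \<sigma>_def by simp
qed

section \<open>The product of a set with its triple sums\<close>

lemma prod_triple_sum_eq: "prod_triple_sum A = A * (A + (A + A))"
proof
  show "prod_triple_sum A \<subseteq> A * (A + (A + A))"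
    by (auto simp: prod_triple_sum_def add.assoc intro!: set_times_intro set_plus_intro)
  show "A * (A + (A + A)) \<subseteq> prod_triple_sum A"
  proof
    fix x assume "x \<in> A * (A + (A + A))"
    then obtain a b c d where "x = a * (b + (c + d))" "a \<in> A" "b \<in> A" "c \<in> A" "d \<in> A"
      by (elim set_times_elim set_plus_elim) auto
    then show "x \<in> prod_triple_sum A" unfolding prod_triple_sum_def by (force simp: add.assoc)
  qed
qed

lemma finite_prod_triple_sum: "finite A \<Longrightarrow> finite (prod_triple_sum A)"
  by (simp add: prod_triple_sum_eq finite_set_times finite_set_plus)

lemma prod_triple_sum_mono: "A \<subseteq> B \<Longrightarrow> prod_triple_sum A \<subseteq> prod_triple_sum B"
  unfolding prod_triple_sum_eq by (intro set_times_mono2 set_plus_mono2)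

lemma prod_triple_sum_uminus: "prod_triple_sum (uminus ` A) = prod_triple_sum A"
proof -
  have sub: "prod_triple_sum (uminus ` B) \<subseteq> prod_triple_sum B" for B
  proof
    fix x assume "x \<in> prod_triple_sum (uminus ` B)"
    then obtain a b c d where *: "x = - a * (- b + - c + - d)" "a \<in> B" "b \<in> B" "c \<in> B" "d \<in> B"
      unfolding prod_triple_sum_def by blast
    then have "x = a * (b + c + d)" by (simp add: algebra_simps)
    with * show "x \<in> prod_triple_sum B" unfolding prod_triple_sum_def by blast
  qed
  have "uminus ` uminus ` A = A" by (simp add: image_image)
  with sub[of A] sub[of "uminus ` A"] show ?thesis by auto
qed

text \<open>For a nonzero a in \<open>A\<close> the map x \<mapsto> a (x + a + a) is injective. This
  keeps the logarithm in the final bound at least 1.\<close>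

lemma card_le_card_prod_triple_sum:
  assumes "finite A" and "2 \<le> card A"
  shows "card A \<le> card (prod_triple_sum A)"
proof -
  have "\<not> A \<subseteq> {0}" using assms card_mono[of "{0}" A] by auto
  then obtain a where a: "a \<in> A" "a \<noteq> 0" by auto
  show ?thesis
  proof (rule card_inj_on_le)
    show "inj_on (\<lambda>x. a * (x + a + a)) A" using a by (auto simp: inj_on_def)
    show "(\<lambda>x. a * (x + a + a)) ` A \<subseteq> prod_triple_sum A"
      unfolding prod_triple_sum_def using a by blast
  qed (use assms finite_prod_triple_sum in auto)
qed

text \<open>The 39th power of \<open>1\<close> leaves E^39, split as E^24 E^15 between
  \<open>3\<close> and \<open>2\<close>. This split makes \<sigma> cancel: \<sigma>^39 stands on the
  left, and 9 + 2 * 15 = 39 on the right. The power of n that remains is 5 * 39 - 58 = 137.\<close>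

lemma combine_energy_bounds:
  fixes n \<sigma> E X J c c' :: real
  assumes pos: "n > 0" "\<sigma> > 0" "E > 0" "J \<ge> 0" "X \<ge> 0" "c \<ge> 0" "c' \<ge> 0"
    and 1: "n ^ 5 * \<sigma> \<le> c * J ^ 4 * X\<^sup>2 * E"
    and 2: "E \<le> 8 * J * \<sigma>\<^sup>2"
    and 3: "E ^ 24 \<le> c' * J ^ 34 * n ^ 58 * \<sigma> ^ 9"
  shows "n ^ 137 \<le> c ^ 39 * c' * 8 ^ 15 * J ^ 205 * X ^ 78"
proof -
  have "E ^ 24 * E ^ 15 \<le> (c' * J ^ 34 * n ^ 58 * \<sigma> ^ 9) * (8 * J * \<sigma>\<^sup>2) ^ 15"
    by (rule mult_mono[OF 3 power_mono[OF 2]]) (use pos in auto)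
  also have "\<dots> = c' * 8 ^ 15 * (J ^ 34 * J ^ 15) * n ^ 58 * (\<sigma> ^ 9 * \<sigma> ^ 30)"
    by (simp only: power_mult_distrib mult_ac flip: power_mult) simp
  finally have E: "E ^ 39 \<le> c' * 8 ^ 15 * J ^ 49 * n ^ 58 * \<sigma> ^ 39"
    unfolding power_add[symmetric] by simp
  have "(n ^ 5 * \<sigma>) ^ 39 \<le> (c * J ^ 4 * X\<^sup>2 * E) ^ 39"
    using 1 pos by (intro power_mono) auto
  also have "\<dots> = c ^ 39 * J ^ 156 * X ^ 78 * E ^ 39"
    by (simp add: power_mult_distrib flip: power_mult)
  also have "\<dots> \<le> c ^ 39 * J ^ 156 * X ^ 78 * (c' * 8 ^ 15 * J ^ 49 * n ^ 58 * \<sigma> ^ 39)"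
    using pos by (intro mult_left_mono E) auto
  also have "\<dots> = (n ^ 58 * \<sigma> ^ 39) * (c ^ 39 * c' * 8 ^ 15 * (J ^ 156 * J ^ 49) * X ^ 78)"
    by (simp only: mult_ac)
  also have "(n ^ 5 * \<sigma>) ^ 39 = (n ^ 58 * \<sigma> ^ 39) * n ^ 137"
  proof -
    have "(n ^ 5 * \<sigma>) ^ 39 = n ^ 195 * \<sigma> ^ 39" by (simp add: power_mult_distrib flip: power_mult)
    moreover have "n ^ 58 * n ^ 137 = n ^ 195" by (simp flip: power_add)
    ultimately show ?thesis by (simp add: mult_ac)
  qed
  finally have "(n ^ 58 * \<sigma> ^ 39) * n ^ 137 \<le> (n ^ 58 * \<sigma> ^ 39) * (c ^ 39 * c' * 8 ^ 15 * (J ^ 156 * J ^ 49) * X ^ 78)" .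
  moreover have "n ^ 58 * \<sigma> ^ 39 > 0" using pos by simp
  ultimately have "n ^ 137 \<le> c ^ 39 * c' * 8 ^ 15 * (J ^ 156 * J ^ 49) * X ^ 78"
    by (simp only: mult_le_cancel_left_pos)
  then show ?thesis unfolding power_add[symmetric] by simp
qed

text \<open>The square in the condition on \<open>J\<close> makes one dyadic range serve both
  \<open>A\<close> and \<open>A + A\<close>, whose size is at most |A|^2.\<close>

lemma card_prod_triple_sum_of_pos:
  obtains K :: real where "K \<ge> 1"
    and "\<And>A J. \<lbrakk>finite A; A \<noteq> {}; \<And>a. a \<in> A \<Longrightarrow> a > 0; (card A)\<^sup>2 < 2 ^ J\<rbrakk> \<Longrightarrow>
      real (card A) ^ 137 \<le> K * real J ^ 205 * real (card (prod_triple_sum A)) ^ 78"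
proof -
  define c' :: real where "c' = 4 ^ 24 * 2 ^ 56 * 162 ^ 5"
  define K :: real where "K = 10816 ^ 39 * c' * 8 ^ 15"
  have bound: "real (card A) ^ 137 \<le> K * real J ^ 205 * real (card (prod_triple_sum A)) ^ 78"
    if A: "finite A" "A \<noteq> {}" "\<And>a. a \<in> A \<Longrightarrow> a > 0" and J: "(card A)\<^sup>2 < 2 ^ J" for A J
  proof -
    have fS: "finite (A + A)" using A by (simp add: finite_set_plus)
    have AS: "card A \<le> card (A + A)" by (intro card_le_card_plus A)
    have "card (A + A) \<le> card (A \<times> A)" unfolding set_plus_image using A by (intro card_image_le) auto
    then have JS: "card (A + A) < 2 ^ J" using J by (simp add: card_cartesian_product power2_eq_square)
    then have JA: "card A < 2 ^ J" using AS by simp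
    have cA: "card A > 0" using A by (simp add: card_gt_0_iff)
    have "(card A)\<^sup>2 \<le> (card (A + A))\<^sup>2" using AS by (intro power_mono) auto
    then have rS: "card (ratios A) \<le> (card (A + A))\<^sup>2" using card_ratios_le[OF A(1)] by linarith
    have "A + A \<noteq> {}" using cA AS by auto
    then have "real (card A) ^ 4 * real (card A) * real (card (A + A))
        \<le> 10816 * real J ^ 4 * (real (card (A * (A + (A + A)))))\<^sup>2 * mult_energy A"
      by (intro card_mult_add_lower_bound A fS card_ratios_le rS JA JS)
    then have "real (card A) ^ 5 * real (card (A + A))
        \<le> 10816 * real J ^ 4 * (real (card (prod_triple_sum A)))\<^sup>2 * mult_energy A"
      by (simp add: prod_triple_sum_eq eval_nat_numeral mult_ac)
    moreover have "mult_energy A \<le> 8 * real J * (real (card (A + A)))\<^sup>2"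
      by (intro mult_energy_le_sumset A JA)
    moreover have "mult_energy A ^ 24 \<le> c' * real J ^ 34 * real (card A) ^ 58 * real (card (A + A)) ^ 9"
      unfolding c'_def by (intro mult_energy_power_le_sumset A JA)
    ultimately show ?thesis
      unfolding K_def
      by (intro combine_energy_bounds[where \<sigma> = "real (card (A + A))" and E = "mult_energy A"])
        (use cA AS mult_energy_pos[OF A] in \<open>auto simp: c'_def\<close>)
  qed
  have "K \<ge> 1" by (simp add: K_def c'_def)
  then show thesis using bound by (rule that)
qed

text \<open>The larger of the positive and the negative part is taken, the latter reflected: the two
  signs in a (b + c + d) cancel, so reflection does not change the products. Dropping 0 and the
  smaller part costs a factor of at most 4.\<close>

lemma obtain_positive_part:
  fixes A :: "real set"
  assumes "finite A" and "2 \<le> card A"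
  obtains B where "finite B" "B \<noteq> {}" "\<And>b. b \<in> B \<Longrightarrow> b > 0" "card B \<le> card A" "card A \<le> 4 * card B"
    "card (prod_triple_sum B) \<le> card (prod_triple_sum A)"
proof -
  define P N where "P = {a \<in> A. a > 0}" and "N = {a \<in> A. a < 0}"
  have fin: "finite P" "finite N" using assms by (auto simp: P_def N_def)
  have sub: "P \<subseteq> A" "N \<subseteq> A" by (auto simp: P_def N_def)
  have "card A \<le> card (insert 0 (P \<union> N))" using fin by (intro card_mono) (auto simp: P_def N_def)
  also have "\<dots> \<le> 1 + (card P + card N)"
    using fin card_insert_le_m1[of "1 + (card P + card N)" "P \<union> N" 0] card_Un_le[of P N] by simp
  finally have cA: "card A \<le> 1 + (card P + card N)" .
  have cX: "card (prod_triple_sum P) \<le> card (prod_triple_sum A)" "card (prod_triple_sum N) \<le> card (prod_triple_sum A)"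
    using assms sub by (auto intro!: card_mono finite_prod_triple_sum prod_triple_sum_mono)
  have cN: "card (uminus ` N) = card N" by (simp add: card_image)
  show ?thesis
  proof (cases "card N \<le> card P")
    case True
    then have "card P > 0" and 4: "card A \<le> 4 * card P" using cA assms by linarith+
    then have "P \<noteq> {}" by auto
    then show ?thesis
      using that[of P] fin(1) 4 cX(1) card_mono[OF assms(1) sub(1)] unfolding P_def by blast
  next
    case False
    then have "card N > 0" and 4: "card A \<le> 4 * card N" using cA assms by linarith+
    then have "uminus ` N \<noteq> {}" by auto
    moreover have "\<And>b. b \<in> uminus ` N \<Longrightarrow> b > 0" by (auto simp: N_def)
    moreover have "card (uminus ` N) \<le> card A" "card A \<le> 4 * card (uminus ` N)"
      using 4 cN card_mono[OF assms(1) sub(2)] by simp_all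
    moreover have "card (prod_triple_sum (uminus ` N)) \<le> card (prod_triple_sum A)"
      using cX(2) by (simp only: prod_triple_sum_uminus)
    ultimately show ?thesis using that[of "uminus ` N"] fin(2) by blast
  qed
qed

theorem theorem2p8:
  shows "\<exists>C c :: real. C > 0 \<and> c > 0 \<and>
    (\<forall>A :: real set. finite A \<longrightarrow>
       real (card (prod_triple_sum A)) \<ge>
         c * real (card A) powr (7/4 + 1/284) / (log 2 (real (card (prod_triple_sum A)))) powr C)"
proof -
  obtain K where K: "K \<ge> 1" 
    and bound: "\<And>A J. \<lbrakk>finite A; A \<noteq> {}; \<And>a. a \<in> A \<Longrightarrow> a > 0; (card A)\<^sup>2 < 2 ^ J\<rbrakk> \<Longrightarrow>
      real (card A) ^ 137 \<le> K * real J ^ 205 * real (card (prod_triple_sum A)) ^ 78"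
    by (rule card_prod_triple_sum_of_pos) blast
  \<comment> \<open>4^137 pays for the passage to a positive set, 3^205 for J \<le> 3 log X.\<close>
  define K' where "K' = 4 ^ 137 * K * 3 ^ 205"
  have K': "K' \<ge> 1"
    unfolding K'_def using K by (intro mult_ge1_I) auto
  have main: "real (card (prod_triple_sum A)) \<ge>
      1 / K' * real (card A) powr (7/4 + 1/284) / (log 2 (real (card (prod_triple_sum A)))) powr 3"
    if A: "finite A" for A
  proof (cases "2 \<le> card A")
    case False
    then consider "card A = 0" | "card A = 1" by linarith
    then show ?thesis
    proof cases
      \<comment> \<open>There is only one product, so the logarithm is 0 and the right side is a
        division by zero, which has the value 0.\<close>
      case 2
      then obtain a where "A = {a}" by (auto simp: card_1_singleton_iff)
      then have "prod_triple_sum A = {a * (a + a + a)}" by (auto simp: prod_triple_sum_def)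
      then show ?thesis by simp
    qed simp
  next
    case True
    define n X l where "n = real (card A)" and "X = real (card (prod_triple_sum A))" and "l = log 2 X"
    have nX: "n \<le> X" using card_le_card_prod_triple_sum[OF A True] by (simp add: n_def X_def)
    have n: "n \<ge> 2" using True by (simp add: n_def)
    have l: "l \<ge> 1" unfolding l_def using n nX by (simp add: le_log_iff)
    obtain B where B: "finite B" "B \<noteq> {}" "\<And>b. b \<in> B \<Longrightarrow> b > 0" "card B \<le> card A" "card A \<le> 4 * card B"
      "card (prod_triple_sum B) \<le> card (prod_triple_sum A)"
      using obtain_positive_part[OF A True] by metis
    define m where "m = real (card B)"
    have m: "m > 0" "m \<le> n" "n \<le> 4 * m" using B by (auto simp: m_def n_def card_gt_0_iff)
    define J where "J = floor_log ((card B)\<^sup>2) + 1"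
    have "(card B)\<^sup>2 < 2 ^ J" using floor_log_exp2_gt[of "(card B)\<^sup>2"] by (simp add: J_def)
    then have b1: "m ^ 137 \<le> K * real J ^ 205 * real (card (prod_triple_sum B)) ^ 78"
      unfolding m_def by (intro bound B)
    \<comment> \<open>J is at most 2 log m + 1, and the 1 is absorbed because l \<ge> 1.\<close>
    have "real J \<le> 3 * l"
    proof -
      have "real (2 ^ floor_log ((card B)\<^sup>2)) \<le> real ((card B)\<^sup>2)"
        using m by (intro of_nat_mono floor_log_exp2_le) (simp add: m_def)
      then have "2 ^ floor_log ((card B)\<^sup>2) \<le> m\<^sup>2" by (simp add: m_def)
      then have "real (floor_log ((card B)\<^sup>2)) \<le> log 2 (m\<^sup>2)"
        using m by (simp add: le_log_iff powr_realpow)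
      also have "\<dots> = 2 * log 2 m" using m by (simp add: log_nat_power)
      also have "\<dots> \<le> 2 * l" using m n nX by (simp add: l_def)
      finally show ?thesis using l by (simp add: J_def)
    qed
    then have J: "real J ^ 205 \<le> 3 ^ 205 * l ^ 205"
      unfolding power_mult_distrib[symmetric] by (intro power_mono) auto
    have "n ^ 137 \<le> (4 * m) ^ 137" using m n by (intro power_mono) auto
    also have "\<dots> = 4 ^ 137 * m ^ 137" by (simp only: power_mult_distrib)
    also have "\<dots> \<le> 4 ^ 137 * (K * (3 ^ 205 * l ^ 205) * X ^ 78)"
    proof (intro mult_left_mono)
      have "K * real J ^ 205 * real (card (prod_triple_sum B)) ^ 78 \<le> K * (3 ^ 205 * l ^ 205) * X ^ 78"
        using J K l B(6) by (intro mult_mono power_mono) (auto simp: X_def)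
      with b1 show "m ^ 137 \<le> K * (3 ^ 205 * l ^ 205) * X ^ 78" by linarith
    qed auto
    also have "\<dots> = K' * (l ^ 205 * X ^ 78)" by (simp only: K'_def mult_ac)
    \<comment> \<open>205 is rounded up to 234 = 3 * 78, so that the 78th root leaves l^3; hence C =
      3.\<close>
    also have "\<dots> \<le> K' * (l ^ 234 * X ^ 78)"
      using l K' by (intro mult_left_mono mult_right_mono power_increasing) (auto simp: X_def)
    also have "\<dots> = K' * (l ^ 3 * X) ^ 78" by (simp add: power_mult_distrib flip: power_mult)
    finally have n137: "n ^ 137 \<le> K' * (l ^ 3 * X) ^ 78" .
    define y where "y = n powr (7/4 + 1/284)"
    have "y ^ 78 = n powr ((7/4 + 1/284) * 78)"
      using n by (simp add: y_def powr_powr flip: powr_realpow)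
    \<comment> \<open>78 (7/4 + 1/284) is about 136.8; this is the only place where the claimed
      exponent is compared with 137/78.\<close>
    also have "\<dots> \<le> n powr 137" using n by (intro powr_mono) auto
    also have "\<dots> = n ^ 137" using n powr_realpow[of n 137] by simp
    finally have y: "y ^ 78 \<le> K' * (l ^ 3 * X) ^ 78" using n137 by linarith
    have "(1 / K' * y) ^ 78 = (1 / K') ^ 78 * y ^ 78" by (rule power_mult_distrib)
    \<comment> \<open>Since \<open>K'\<close> is at least 1, one of the 78 factors
      \<open>1 / K'\<close> already cancels the constant, and no root of it is needed.\<close>
    also have "\<dots> \<le> (1 / K') ^ 1 * (K' * (l ^ 3 * X) ^ 78)"
      using K' by (intro mult_mono[OF power_decreasing y]) (auto simp: y_def)
    also have "\<dots> = (l ^ 3 * X) ^ 78" using K' by simp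
    finally have "1 / K' * y \<le> l ^ 3 * X"
      by (rule power_le_imp_le_base[of _ 77, simplified]) (use l in \<open>auto simp: X_def\<close>)
    then have "1 / K' * y / l ^ 3 \<le> X" using l by (subst pos_divide_le_eq) (auto simp: mult.commute)
    then have "1 / K' * y / l powr 3 \<le> X" using l by simp
    then show ?thesis unfolding y_def l_def n_def X_def .
  qed
  show ?thesis
    using main K' by (intro exI[of _ 3] exI[of _ "1 / K'"]) auto
qed

end
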